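(* Let $\beta\in\{1,2,4\}$, let $d\ge 1$, and let $A_1,A_2,\ldots$ be independent $d\times d$ Gaussian matrices with covariance matrix $\Sigma$, whose entries are real, complex or quaternion according to whether $\beta=1$, $2$ or $4$. Let the eigenvalues of $\Sigma$ (with multiplicity) be $\sigma_i^2=1/y_i$, $i=1,\ldots,d$, with $y_i>0$. Then the largest Lyapunov exponent $\mu_1$ of the matrices $A_i$ satisfies $$2\mu_1=-\gamma+\log\left(\frac{2}{\beta}\right)+\int_0^\infty\left[\mathbf 1_{[0,1]}(x)-\prod_{i=1}^d\left(1+\frac{x}{y_i}\right)^{-\beta/2}\right]\frac{dx}{x},$$ where $\gamma\approx 0.5772$ is the Euler constant and $\mathbf 1_{[0,1]}$ is the indicator function of $[0,1]$.
   Context: Gaussian matrices: let $\beta=1,2,4$ correspond to real, complex, quaternion scalars respectively, and let $\Sigma$ be a $d\times d$ positive definite self-adjoint matrix over these scalars (real symmetric, complex Hermitian, or quaternion self-adjoint). A $d\times d$ Gaussian matrix with covariance matrix $\Sigma$ is a random matrix distributed as $\Sigma^{1/2}G$, where $G$ is a $d\times d$ matrix with independent real, complex or quaternion entries, the $\beta$ real components of each entry being independent centered real Gaussian variables with variance $1/\beta$ (so each entry $g$ of $G$ has $\mathbb E|g|^2=1$). The $A_i$ are independent and identically distributed. Largest Lyapunov exponent: with $P_n:=A_nA_{n-1}\cdots A_1$, it is the (almost sure, deterministic) limit $\mu_1=\lim_{n\to\infty}n^{-1}\log\|P_n\|$, where $\|\cdot\|$ is the operator norm. *)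

theory Defs
  imports "HOL-Probability.Probability"
begin

section \<open>Quaternions\<close>

codatatype quat = Quat (QRe: real) (QI: real) (QJ: real) (QK: real)

lemma quat_eq_iff: "x = y \<longleftrightarrow> QRe x = QRe y \<and> QI x = QI y \<and> QJ x = QJ y \<and> QK x = QK y"
  by (auto intro: quat.expand)

instantiation quat :: ab_group_add
begin

primcorec zero_quat where
  "QRe 0 = 0" | "QI 0 = 0" | "QJ 0 = 0" | "QK 0 = 0"

primcorec plus_quat where
  "QRe (x + y) = QRe x + QRe y"
| "QI (x + y) = QI x + QI y"
| "QJ (x + y) = QJ x + QJ y"
| "QK (x + y) = QK x + QK y"

primcorec uminus_quat where
  "QRe (- x) = - QRe x" | "QI (- x) = - QI x" | "QJ (- x) = - QJ x" | "QK (- x) = - QK x"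

primcorec minus_quat where
  "QRe (x - y) = QRe x - QRe y"
| "QI (x - y) = QI x - QI y"
| "QJ (x - y) = QJ x - QJ y"
| "QK (x - y) = QK x - QK y"

instance
  by standard (simp_all add: quat_eq_iff)

end

instantiation quat :: real_algebra_1
begin

primcorec one_quat where
  "QRe 1 = 1" | "QI 1 = 0" | "QJ 1 = 0" | "QK 1 = 0"

primcorec times_quat where
  "QRe (x * y) = QRe x * QRe y - QI x * QI y - QJ x * QJ y - QK x * QK y"
| "QI (x * y) = QRe x * QI y + QI x * QRe y + QJ x * QK y - QK x * QJ y"
| "QJ (x * y) = QRe x * QJ y - QI x * QK y + QJ x * QRe y + QK x * QI y"
| "QK (x * y) = QRe x * QK y + QI x * QJ y - QJ x * QI y + QK x * QRe y"

primcorec scaleR_quat where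
  "QRe (scaleR r x) = r * QRe x"
| "QI (scaleR r x) = r * QI x"
| "QJ (scaleR r x) = r * QJ x"
| "QK (scaleR r x) = r * QK x"

instance
  by standard (simp_all add: quat_eq_iff algebra_simps)

end

primcorec qcnj :: "quat \<Rightarrow> quat" where
  "QRe (qcnj x) = QRe x" | "QI (qcnj x) = - QI x" | "QJ (qcnj x) = - QJ x" | "QK (qcnj x) = - QK x"

lemma quat_nonzero_sq:
  assumes "x \<noteq> (0::quat)"
  shows "(QRe x)\<^sup>2 + (QI x)\<^sup>2 + (QJ x)\<^sup>2 + (QK x)\<^sup>2 > 0"
proof -
  have "QRe x \<noteq> 0 \<or> QI x \<noteq> 0 \<or> QJ x \<noteq> 0 \<or> QK x \<noteq> 0"
    using assms by (auto simp: quat_eq_iff)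
  then show ?thesis
    by (elim disjE) (simp_all add: add_nonneg_pos add_pos_nonneg)
qed

instantiation quat :: real_div_algebra
begin

definition inverse_quat :: "quat \<Rightarrow> quat" where
  "inverse x = inverse ((QRe x)\<^sup>2 + (QI x)\<^sup>2 + (QJ x)\<^sup>2 + (QK x)\<^sup>2) *\<^sub>R qcnj x"

definition divide_quat :: "quat \<Rightarrow> quat \<Rightarrow> quat" where
  "x div y = x * inverse y" for x y :: quat

lemma quat_mult_qcnj:
  "x * qcnj x = ((QRe x)\<^sup>2 + (QI x)\<^sup>2 + (QJ x)\<^sup>2 + (QK x)\<^sup>2) *\<^sub>R 1"
  "qcnj x * x = ((QRe x)\<^sup>2 + (QI x)\<^sup>2 + (QJ x)\<^sup>2 + (QK x)\<^sup>2) *\<^sub>R 1"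
  by (simp_all add: quat_eq_iff power2_eq_square)

instance
proof
  fix x :: quat
  assume "x \<noteq> 0"
  from quat_nonzero_sq[OF this] show "inverse x * x = 1" "x * inverse x = 1"
    by (simp_all add: inverse_quat_def quat_mult_qcnj)
next
  fix x y :: quat
  show "x div y = x * inverse y"
    by (fact divide_quat_def)
next
  show "inverse (0::quat) = 0"
    by (simp add: inverse_quat_def)
qed

end

instantiation quat :: real_inner
begin

definition inner_quat :: "quat \<Rightarrow> quat \<Rightarrow> real" where
  "inner x y = QRe x * QRe y + QI x * QI y + QJ x * QJ y + QK x * QK y"

definition norm_quat :: "quat \<Rightarrow> real" where
  "norm x = sqrt ((QRe x)\<^sup>2 + (QI x)\<^sup>2 + (QJ x)\<^sup>2 + (QK x)\<^sup>2)" for x :: quat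

definition sgn_quat :: "quat \<Rightarrow> quat" where
  "sgn x = x /\<^sub>R norm x" for x :: quat

definition dist_quat :: "quat \<Rightarrow> quat \<Rightarrow> real" where
  "dist x y = norm (x - y)" for x y :: quat

definition uniformity_quat :: "(quat \<times> quat) filter" where
  "uniformity = (INF e\<in>{0 <..}. principal {(x, y :: quat). dist x y < e})"

definition open_quat :: "quat set \<Rightarrow> bool" where
  "open U \<longleftrightarrow> (\<forall>x\<in>U. eventually (\<lambda>(x', y). x' = x \<longrightarrow> y \<in> U) uniformity)" for U :: "quat set"

instance
proof
  fix x y z :: quat and r :: real
  show "inner x y = inner y x"
    by (simp add: inner_quat_def mult.commute)
  show "inner (x + y) z = inner x z + inner y z"
    by (simp add: inner_quat_def algebra_simps)
  show "inner (r *\<^sub>R x) y = r * inner x y"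
    by (simp add: inner_quat_def algebra_simps)
  show "0 \<le> inner x x"
    by (simp add: inner_quat_def)
  show "inner x x = 0 \<longleftrightarrow> x = 0"
    using quat_nonzero_sq[of x] by (cases "x = 0") (simp_all add: inner_quat_def power2_eq_square)
  show "norm x = sqrt (inner x x)"
    by (simp add: inner_quat_def norm_quat_def power2_eq_square)
qed (simp_all add: sgn_quat_def dist_quat_def uniformity_quat_def open_quat_def)

end

instance quat :: real_normed_div_algebra
proof
  show "norm (x * y) = norm x * norm y" for x y :: quat
    unfolding norm_quat_def real_sqrt_mult[symmetric] times_quat.simps
    by (rule arg_cong[where f = sqrt]) algebra
qed

instantiation quat :: euclidean_space
begin

definition Basis_quat :: "quat set" where
  "Basis = {Quat 1 0 0 0, Quat 0 1 0 0, Quat 0 0 1 0, Quat 0 0 0 1}"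

instance
proof
  fix u v x :: quat
  show "(Basis :: quat set) \<noteq> {}" "finite (Basis :: quat set)"
    by (simp_all add: Basis_quat_def)
  show "u \<in> Basis \<Longrightarrow> v \<in> Basis \<Longrightarrow> inner u v = (if u = v then 1 else 0)"
    unfolding Basis_quat_def by (elim insertE emptyE) (simp_all add: inner_quat_def)
  show "(\<forall>u\<in>Basis. inner x u = 0) \<longleftrightarrow> x = 0"
    by (simp add: Basis_quat_def inner_quat_def quat_eq_iff[of x 0])
qed

end

lemma DIM_quat [simp]: "DIM(quat) = 4"
  by (simp add: Basis_quat_def)


section \<open>Real, complex and quaternion scalars\<close>

text \<open>
  The class serves to treat the three scalar types uniformly; the parameter beta is
  \<^term>\<open>DIM('a::euclidean_space)\<close>. The axiom says that conjugation fixes the reals and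
  negates their orthogonal complement.
\<close>

class star_scalar = real_normed_div_algebra + euclidean_space +
  fixes conjg :: "'a \<Rightarrow> 'a"
  assumes conjg_eq: "conjg x = (2 * inner x 1) *\<^sub>R 1 - x"

instantiation real :: star_scalar
begin
definition conjg_real :: "real \<Rightarrow> real" where "conjg x = x" for x :: real
instance by standard (simp add: conjg_real_def)
end

instantiation complex :: star_scalar
begin
definition conjg_complex :: "complex \<Rightarrow> complex" where "conjg = cnj"
instance by standard (simp add: conjg_complex_def complex_eq_iff inner_complex_def)
end

instantiation quat :: star_scalar
begin
definition conjg_quat :: "quat \<Rightarrow> quat" where "conjg = qcnj"
instance by standard (simp add: conjg_quat_def quat_eq_iff inner_quat_def)
end


section \<open>Self-adjoint matrices\<close>

definition self_adjoint :: "'a::star_scalar ^ 'n ^ 'n \<Rightarrow> bool" where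
  "self_adjoint S \<longleftrightarrow> (\<forall>i j. S $ j $ i = conjg (S $ i $ j))"

text \<open>
  The library's inner product on the vector type is the real part of the sesquilinear one, and
  the sesquilinear form of a self-adjoint matrix is real on the diagonal.
\<close>

definition positive_definite :: "'a::star_scalar ^ 'n ^ 'n \<Rightarrow> bool" where
  "positive_definite S \<longleftrightarrow> self_adjoint S \<and> (\<forall>v. v \<noteq> 0 \<longrightarrow> inner v (S *v v) > 0)"

definition pd_sqrt :: "'a::star_scalar ^ 'n ^ 'n \<Rightarrow> 'a ^ 'n ^ 'n" where
  "pd_sqrt S = (THE R. positive_definite R \<and> R ** R = S)"

text \<open>
  The family \<open>l\<close> lists the eigenvalues of the self-adjoint matrix \<open>S\<close> with multiplicity.
  Eigenvalues of self-adjoint matrices are real. Over the quaternions vectors are a right module,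
  so an eigenvector satisfies \<open>S v = v t\<close>; for real \<open>t\<close> this is \<open>S v = t v\<close>. As \<^const>\<open>dim\<close> is
  the real dimension, it is \<^term>\<open>DIM('a::euclidean_space)\<close> times the dimension over the scalars.
\<close>

definition eigenvalues_with_mult :: "'a::star_scalar ^ 'n ^ 'n \<Rightarrow> ('n \<Rightarrow> real) \<Rightarrow> bool" where
  "eigenvalues_with_mult S l \<longleftrightarrow>
     (\<forall>t. dim {v. S *v v = t *\<^sub>R v} = DIM('a) * card {i. l i = t})"


section \<open>Gaussian matrices\<close>

text \<open>
  The law of \<open>G\<close>: its real components, indexed by row, column and basis element of the
  scalars, are independent centered Gaussians with variance 1/beta. The second parameter of
  \<^const>\<open>normal_density\<close> is the standard deviation.
\<close>

definition standard_gaussian_law :: "('a::star_scalar ^ 'n ^ 'n) measure" where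
  "standard_gaussian_law =
     distr
       (\<Pi>\<^sub>M k \<in> (UNIV :: 'n set) \<times> (UNIV :: 'n set) \<times> (Basis :: 'a set).
          density lborel (normal_density 0 (1 / sqrt (real DIM('a)))))
       borel
       (\<lambda>w. \<chi> i j. \<Sum>b\<in>Basis. w (i, j, b) *\<^sub>R b)"

definition gaussian_law :: "'a::star_scalar ^ 'n ^ 'n \<Rightarrow> ('a ^ 'n ^ 'n) measure" where
  "gaussian_law S = distr standard_gaussian_law borel (\<lambda>G. pd_sqrt S ** G)"

text \<open>The matrices are indexed from 1; the value at index 0 plays no role.\<close>

definition iid_gaussian_matrices ::
  "'w measure \<Rightarrow> 'a::star_scalar ^ 'n ^ 'n \<Rightarrow> (nat \<Rightarrow> 'w \<Rightarrow> 'a ^ 'n ^ 'n) \<Rightarrow> bool" where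
  "iid_gaussian_matrices M S A \<longleftrightarrow>
     prob_space.indep_vars M (\<lambda>_. borel) A {1..} \<and>
     (\<forall>k\<ge>1. distr M borel (A k) = gaussian_law S)"


section \<open>Lyapunov exponent\<close>

primrec matrix_product :: "(nat \<Rightarrow> 'a::star_scalar ^ 'n ^ 'n) \<Rightarrow> nat \<Rightarrow> 'a ^ 'n ^ 'n" where
  "matrix_product A 0 = mat 1"
| "matrix_product A (Suc n) = A (Suc n) ** matrix_product A n"

definition largest_lyapunov_exponent ::
  "'w measure \<Rightarrow> (nat \<Rightarrow> 'w \<Rightarrow> 'a::star_scalar ^ 'n ^ 'n) \<Rightarrow> real \<Rightarrow> bool" where
  "largest_lyapunov_exponent M A \<mu> \<longleftrightarrow>
     (AE \<omega> in M.
        (\<lambda>n. ln (onorm (\<lambda>v. matrix_product (\<lambda>k. A k \<omega>) n *v v)) / real n) \<longlonglongrightarrow> \<mu>)"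

end

theory Submission
  imports Defs "HOL-Real_Asymp.Real_Asymp"
begin

text \<open>
  Let \<open>u\<close> be a unit vector and \<open>W = |A u|\<^sup>2\<close>. Diagonalising \<open>\<Sigma>\<close>, the Laplace transform of
  \<open>(\<beta>/2) W\<close> is \<open>L(x) = \<Prod>\<^sub>i (1 + x/y\<^sub>i) powr (-\<beta>/2)\<close>, whatever \<open>u\<close> is. It determines the moments
  \<open>E |A u| powr s\<close> for small \<open>s\<close> of either sign, say \<open>d(s)\<close>. Conditioning on the previous factors
  gives \<open>E |P\<^sub>n u| powr s = d(s)\<^sup>n\<close>, so by Markov's inequality and Borel-Cantelli
  \<open>ln |P\<^sub>n u| / n\<close> tends almost surely to \<open>d'(0) = E ln W / 2\<close>. The operator norm of \<open>P\<^sub>n\<close> lies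
  between \<open>max |P\<^sub>n e\<^sub>j|\<close> and \<open>\<Sum> |P\<^sub>n e\<^sub>j|\<close> over the standard basis, so it has the same growth rate.
  Finally \<open>\<gamma> + ln w\<close> is the integral of \<open>(1\<^bsub>[0,1]\<^esub>(x) - exp (-x w)) / x\<close> over \<open>x > 0\<close>, and
  averaging over \<open>w = (\<beta>/2) W\<close> replaces \<open>exp (-x w)\<close> by \<open>L(x)\<close>.
\<close>

section \<open>Self-adjoint matrices over the scalars\<close>

text \<open>Quaternions do not commute, so the linear algebra is done in the real inner product
  space of dimension \<beta>d. There every eigenvalue of \<Sigma> occurs \<beta> times, and each
  occurrence contributes an exponent -1/2; this is where -\<beta>/2 comes from. The direction of
  \<open>P_n u\<close> is random, so treating its successive growth factors as an i.i.d. sequence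
  would require conditioning on directions. Moments avoid this: they multiply exactly once
  \<open>E |A u| powr s\<close> is the same for all unit \<open>u\<close>. Equality of the laws of
  \<open>|A u|\<close> is never established; an explicit formula carries equal Laplace transforms to
  equal moments. Positive \<open>s\<close> bounds the growth from above. Negative \<open>s\<close>
  bounds it from below, and there the range is limited: for d = \<beta> = 1 the density of
  \<open>(\<beta>/2) W\<close> behaves like \<open>w powr (-1/2)\<close> near 0, so moments of order
  at most -1/2 diverge. Hence the window \<open>|s| < 1/2\<close> for moments of
  \<open>W\<close>.\<close>

lemma inner_mult_mult_left: "inner (x * a) (x * b) = (norm x)\<^sup>2 * inner a b"
  for x a b :: "'a::star_scalar"
  \<comment> \<open>Polarisation: the norm is multiplicative, and inner products are determined by
    norms.\<close>
  by (simp only: dot_norm norm_mult power_mult_distrib flip: distrib_left) (simp add: field_simps)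

lemma inner_mult_mult_right: "inner (a * x) (b * x) = (norm x)\<^sup>2 * inner a b"
  for x a b :: "'a::star_scalar"
  by (simp only: dot_norm norm_mult power_mult_distrib flip: distrib_right) (simp add: field_simps)

text \<open>Expanding the scaling identity at \<open>x + 1\<close> leaves the cross terms
  \<open>inner (x * a) b + inner a (x * b) = 2 * inner x 1 * inner a b\<close>, and
  \<open>conjg_eq\<close> absorbs the right-hand side. All three scalar types are covered without
  coordinates.\<close>

lemma inner_mult_left_conjg: "inner (x * a) b = inner a (conjg x * b)"
  for x a b :: "'a::star_scalar"
proof -
  have "inner ((x + 1) * a) ((x + 1) * b) = (norm (x + 1))\<^sup>2 * inner a b"
    by (rule inner_mult_mult_left)
  moreover have "(norm (x + 1))\<^sup>2 = (norm x)\<^sup>2 + 2 * inner x 1 + 1"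
    by (simp add: power2_norm_eq_inner algebra_simps inner_commute norm_eq_1[THEN iffD1])
  ultimately show ?thesis
    by (simp add: conjg_eq algebra_simps inner_mult_mult_left)
qed

lemma inner_mult_right_conjg: "inner (a * x) b = inner a (b * conjg x)"
  for x a b :: "'a::star_scalar"
proof -
  have "inner (a * (x + 1)) (b * (x + 1)) = (norm (x + 1))\<^sup>2 * inner a b"
    by (rule inner_mult_mult_right)
  moreover have "(norm (x + 1))\<^sup>2 = (norm x)\<^sup>2 + 2 * inner x 1 + 1"
    by (simp add: power2_norm_eq_inner algebra_simps inner_commute norm_eq_1[THEN iffD1])
  ultimately show ?thesis
    by (simp add: conjg_eq algebra_simps inner_mult_mult_right)
qed

lemma norm_conjg [simp]: "norm (conjg x) = norm x" for x :: "'a::star_scalar"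
proof -
  have "inner (conjg x) (conjg x) = inner x x"
    by (simp add: conjg_eq algebra_simps inner_commute norm_eq_1[THEN iffD1])
  then show ?thesis
    by (simp add: norm_eq_sqrt_inner)
qed

lemma matrix_vector_linear: "linear ((*v) A)" for A :: "'a::star_scalar ^ 'n ^ 'm"
  using matrix_vector_mul_bounded_linear[of A] by (simp add: linear_conv_bounded_linear)

lemma self_adjoint_inner:
  fixes S :: "'a::star_scalar ^ 'n ^ 'n"
  assumes "self_adjoint S"
  shows "inner (S *v v) w = inner v (S *v w)"
proof -
  have "inner (S *v v) w = (\<Sum>i\<in>UNIV. \<Sum>j\<in>UNIV. inner (v $ j) (S $ j $ i * w $ i))"
  proof -
    have "conjg (S $ i $ j) = S $ j $ i" for i j
      using assms unfolding self_adjoint_def by metis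
    then show ?thesis
      by (simp add: inner_vec_def matrix_vector_mult_def inner_sum_left inner_mult_left_conjg)
  qed
  also have "\<dots> = inner v (S *v w)"
    by (subst sum.swap) (simp add: inner_vec_def matrix_vector_mult_def inner_sum_right)
  finally show ?thesis .
qed

text \<open>Matrices act from the left and scalars from the right, so the two actions commute even
  over the quaternions.\<close>

lemma matrix_vector_mult_right:
  fixes A :: "'a::star_scalar ^ 'n ^ 'm"
  shows "A *v (\<chi> i. v $ i * q) = (\<chi> i. (A *v v) $ i * q)"
  by (simp add: vec_eq_iff matrix_vector_mult_def sum_distrib_right mult.assoc)

lemma linear_mult_right: "linear (\<lambda>v::'a::star_scalar ^ 'n. \<chi> i. v $ i * q)"
  by (rule linearI) (simp_all add: vec_eq_iff algebra_simps)

section \<open>Real orthonormal eigenbases and the positive definite square root\<close>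

lemma positive_definite_eigenvalue_pos:
  assumes "positive_definite S" "S *v v = t *\<^sub>R v" "v \<noteq> 0"
  shows "t > 0"
proof -
  have "t * inner v v > 0"
    using assms by (metis inner_scaleR_right positive_definite_def)
  then show ?thesis
    by (metis inner_ge_zero zero_less_mult_pos2 mult_zero_right order_le_less order_less_irrefl)
qed

text \<open>The multiplicity hypothesis stands in for the spectral theorem: eigenspaces of different
  eigenvalues are orthogonal, so their orthonormal bases unite to an orthogonal family, and its size
  adds up to the full real dimension. The product formula is the form in which the multiplicities
  enter the Laplace transform.\<close>

lemma eigenvalues_with_mult_eigenbasis:
  fixes S :: "'a::star_scalar ^ 'n ^ 'n"
  assumes sa: "self_adjoint S" and l: "eigenvalues_with_mult S l"
  obtains C e where "finite C" "pairwise orthogonal C" "\<And>c. c \<in> C \<Longrightarrow> norm c = 1"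
    "span C = UNIV" "\<And>c. c \<in> C \<Longrightarrow> S *v c = e c *\<^sub>R c"
    "\<And>f::real \<Rightarrow> real. (\<Prod>c\<in>C. f (e c)) = (\<Prod>i\<in>UNIV. f (l i) ^ DIM('a))"
proof -
  define E where "E t = {v. S *v v = t *\<^sub>R v}" for t
  have sub: "subspace (E t)" for t
    using matrix_vector_linear[of S] unfolding E_def
    by (auto simp: subspace_def linear_add linear_cmul linear_0 algebra_simps)
  have "\<exists>B. B \<subseteq> E t \<and> pairwise orthogonal B \<and> (\<forall>x\<in>B. norm x = 1) \<and> independent B \<and> card B = dim (E t)"
    for t
    using orthonormal_basis_subspace[OF sub[of t]] by metis
  then obtain B where B: "\<And>t. B t \<subseteq> E t" "\<And>t. pairwise orthogonal (B t)"
      "\<And>t x. x \<in> B t \<Longrightarrow> norm x = 1" "\<And>t. independent (B t)" "\<And>t. card (B t) = dim (E t)"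
    by metis
  have fin: "finite (B t)" for t
    using B(4) independent_bound_general by blast
  have card: "card (B t) = DIM('a) * card {i. l i = t}" for t
    using B(5) l by (simp add: eigenvalues_with_mult_def E_def)
  define C where "C = (\<Union>t\<in>range l. B t)"
  have [simp]: "finite C"
    unfolding C_def using fin by auto
  define e where "e c = (THE t. c \<in> E t)" for c
  have e: "e c = t" if "c \<in> E t" "c \<noteq> 0" for c t
    unfolding e_def using that by (intro the_equality) (auto simp: E_def)
  have nz: "c \<noteq> 0" if "c \<in> B t" for c t
    using B(3)[OF that] by auto
  have eB: "e c = t" if "c \<in> B t" for c t
    using e nz that B(1) by blast
  have disj: "B s \<inter> B t = {}" if "s \<noteq> t" for s t
    using eB that by blast
  have orth: "pairwise orthogonal C"
    unfolding pairwise_def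
  proof safe
    fix x y assume "x \<in> C" "y \<in> C" "x \<noteq> y"
    then obtain s t where st: "x \<in> B s" "y \<in> B t" unfolding C_def by blast
    show "orthogonal x y"
    proof (cases "s = t")
      case True
      then show ?thesis using B(2)[of t] st \<open>x \<noteq> y\<close> by (auto simp: pairwise_def)
    next
      case False
      have "s * inner x y = inner (S *v x) y" "inner x (S *v y) = t * inner x y"
        using st B(1)[of s] B(1)[of t] by (auto simp: E_def subset_iff)
      then have "s * inner x y = t * inner x y"
        using self_adjoint_inner[OF sa, of x y] by simp
      then show ?thesis using False by (simp add: orthogonal_def)
    qed
  qed
  have prodC: "(\<Prod>c\<in>C. f (e c)) = (\<Prod>i\<in>UNIV. f (l i) ^ DIM('a))" for f :: "real \<Rightarrow> real"
  proof -
    have "(\<Prod>c\<in>C. f (e c)) = (\<Prod>t\<in>range l. \<Prod>c\<in>B t. f (e c))"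
      unfolding C_def using fin disj by (intro prod.UNION_disjoint) auto
    also have "\<dots> = (\<Prod>t\<in>range l. \<Prod>i | l i = t. f (l i) ^ DIM('a))"
      by (intro prod.cong refl) (simp add: eB card power_mult)
    also have "\<dots> = (\<Prod>i\<in>UNIV. f (l i) ^ DIM('a))"
      using prod.image_gen[of UNIV "\<lambda>i. f (l i) ^ DIM('a)" l] by simp
    finally show ?thesis .
  qed
  have "card C = (\<Sum>t\<in>range l. card (B t))"
    unfolding C_def using fin disj by (intro card_UN_disjoint) auto
  also have "\<dots> = DIM('a) * (\<Sum>t\<in>range l. \<Sum>i | l i = t. 1)"
    by (simp add: card sum_distrib_left)
  also have "\<dots> = DIM('a ^ 'n)"
    using sum.image_gen[of UNIV "\<lambda>_. 1::nat" l] by simp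
  finally have cardC: "card C = DIM('a ^ 'n)" .
  have "independent C"
    using orth nz by (intro pairwise_orthogonal_independent) (auto simp: C_def)
  then have "span C = UNIV"
    using cardC card_eq_dim[of C UNIV] by auto
  show ?thesis
  proof
    show "S *v c = e c *\<^sub>R c" if "c \<in> C" for c
      using that eB B(1) by (fastforce simp: C_def E_def)
    show "norm c = 1" if "c \<in> C" for c
      using that B(3) by (auto simp: C_def)
  qed fact+
qed

lemma inner_eigenbasis:
  fixes v :: "'a::euclidean_space"
  assumes "finite C" "pairwise orthogonal C" "\<And>c. c \<in> C \<Longrightarrow> norm c = 1" "span C = UNIV"
    and S: "linear S" "\<And>c. c \<in> C \<Longrightarrow> S c = e c *\<^sub>R c"
  shows "inner v (S v) = (\<Sum>c\<in>C. e c * (inner v c)\<^sup>2)"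
proof -
  have "S v = S (\<Sum>c\<in>C. inner v c *\<^sub>R c)"
    using orthonormal_basis_expand[of C v] assms by simp
  also have "\<dots> = (\<Sum>c\<in>C. (inner v c * e c) *\<^sub>R c)"
    using S by (simp add: linear_sum linear_cmul)
  finally show ?thesis
    by (simp add: inner_sum_right power2_eq_square mult_ac)
qed

text \<open>
  Two positive definite square roots that commute satisfy \<open>(R' + R) (R' - R) = 0\<close>, where
  \<open>R' + R\<close> is injective.
\<close>

lemma pd_sqrt:
  fixes S :: "'a::star_scalar ^ 'n ^ 'n"
  assumes pd: "positive_definite S" and l: "eigenvalues_with_mult S l"
  shows "positive_definite (pd_sqrt S)" "pd_sqrt S ** pd_sqrt S = S"
proof -
  have sa: "self_adjoint S"
    using pd by (simp add: positive_definite_def)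
  obtain C e where C: "finite C" "pairwise orthogonal C" "\<And>c. c \<in> C \<Longrightarrow> norm c = 1"
    "span C = UNIV" and e: "\<And>c. c \<in> C \<Longrightarrow> S *v c = e c *\<^sub>R c"
    using eigenvalues_with_mult_eigenbasis[OF sa l] by metis
  have exp: "(\<Sum>c\<in>C. inner v c *\<^sub>R c) = v" for v
    using orthonormal_basis_expand[of C v] C by simp
  have pos: "e c > 0" if "c \<in> C" for c
    using positive_definite_eigenvalue_pos[OF pd e[OF that]] C(3)[OF that] by force
  \<comment> \<open>The spectral square root, first only as a real linear map; that it comes from a
    matrix over the scalars has to be shown.\<close>
  define f where "f v = (\<Sum>c\<in>C. (sqrt (e c) * inner v c) *\<^sub>R c)" for v
  have lin: "linear f"
    unfolding f_def by (rule linearI) (simp_all add: algebra_simps sum.distrib scaleR_sum_right)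
  \<comment> \<open>Stated for all eigenvectors and not just those in \<open>C\<close>: right
    multiples of members of \<open>C\<close>, and their images under another root, are eigenvectors
    that need not lie in \<open>C\<close>.\<close>
  have eig: "f v = sqrt t *\<^sub>R v" if "S *v v = t *\<^sub>R v" for v t
  proof -
    have eq: "(sqrt (e c) * inner v c) *\<^sub>R c = sqrt t *\<^sub>R inner v c *\<^sub>R c" if "c \<in> C" for c
    proof -
      have "t * inner v c = e c * inner v c"
        using self_adjoint_inner[OF sa, of v c] \<open>S *v v = _\<close> e[OF that] by simp
      then show ?thesis by auto
    qed
    then have "f v = sqrt t *\<^sub>R (\<Sum>c\<in>C. inner v c *\<^sub>R c)"
      unfolding f_def scaleR_sum_right by (intro sum.cong refl eq)
    then show ?thesis by (simp add: exp)
  qed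
  have fc: "f c = sqrt (e c) *\<^sub>R c" if "c \<in> C" for c
    using eig e that by blast
  have eqI: "g v = h v" if "linear g" "linear h" "\<And>c. c \<in> C \<Longrightarrow> g c = h c" for g h :: "'a ^ 'n \<Rightarrow> 'a ^ 'n" and v
    using linear_eq_on_span[OF that] C(4) by auto
  \<comment> \<open>Commuting with right multiplication is what makes \<open>f\<close> left
    multiplication by the matrix of its values at \<open>axis j 1\<close>.\<close>
  have right: "f (\<chi> i. v $ i * q) = (\<chi> i. f v $ i * q)" for v q
  proof (rule eqI[of "\<lambda>v. f (\<chi> i. v $ i * q)" "\<lambda>v. \<chi> i. f v $ i * q"])
    show "linear (\<lambda>v. f (\<chi> i. v $ i * q))"
      using linear_compose[OF linear_mult_right[of q] lin] by (simp add: o_def)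
    show "linear (\<lambda>v. \<chi> i. f v $ i * q)"
      using linear_compose[OF lin linear_mult_right[of q]] by (simp add: o_def)
    fix c assume "c \<in> C"
    then have "S *v (\<chi> i. c $ i * q) = e c *\<^sub>R (\<chi> i. c $ i * q)"
      by (simp add: matrix_vector_mult_right e vec_eq_iff)
    from eig[OF this] show "f (\<chi> i. c $ i * q) = (\<chi> i. f c $ i * q)"
      using fc[OF \<open>c \<in> C\<close>] by (simp add: vec_eq_iff)
  qed
  define R where "R = (\<chi> i j. f (axis j 1) $ i)"
  have axis_right: "(\<chi> i. (axis j 1 :: 'a ^ 'n) $ i * q) = axis j q" for j q
    by (simp add: vec_eq_iff axis_def)
  have f_axis: "f (axis j q) = (\<chi> i. f (axis j 1) $ i * q)" for j q
    using right[of "axis j 1" q] by (simp only: axis_right)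
  have Rf: "R *v v = f v" for v
  proof -
    have "v = (\<Sum>j\<in>UNIV. axis j (v $ j))"
      by (simp add: vec_eq_iff axis_def)
    then have "f v = (\<Sum>j\<in>UNIV. f (axis j (v $ j)))"
      using lin by (metis linear_sum)
    also have "\<dots> = (\<Sum>j\<in>UNIV. \<chi> i. f (axis j 1) $ i * v $ j)"
      by (rule sum.cong[OF refl f_axis])
    also have "\<dots> = R *v v"
      by (simp add: vec_eq_iff R_def matrix_vector_mult_def)
    finally show ?thesis by simp
  qed
  have sym: "inner (f v) w = inner v (f w)" for v w
    by (simp add: f_def inner_sum_left inner_sum_right inner_commute mult_ac)
  have "self_adjoint R"
    unfolding self_adjoint_def
  proof (intro allI)
    fix i j
    \<comment> \<open>The real inner product sees only the real part of the sesquilinear form;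
      letting \<open>a\<close> vary recovers the whole entry.\<close>
    have "inner a (R $ j $ i) = inner a (conjg (R $ i $ j))" for a
    proof -
      have "inner a (R $ j $ i) = inner (axis j a) (f (axis i 1))"
        by (simp add: R_def inner_axis')
      also have "\<dots> = inner (\<chi> k. f (axis j 1) $ k * a) (axis i 1)"
        by (simp only: flip: sym f_axis)
      also have "\<dots> = inner (R $ i $ j * a) 1"
        by (simp add: inner_axis R_def)
      finally show ?thesis
        by (simp add: inner_mult_left_conjg)
    qed
    then show "R $ j $ i = conjg (R $ i $ j)"
      using vector_eq_ldot by blast
  qed
  moreover have "inner v (R *v v) > 0" if "v \<noteq> 0" for v
  proof -
    have eq: "inner v (R *v v) = (\<Sum>c\<in>C. sqrt (e c) * (inner v c)\<^sup>2)"
      using inner_eigenbasis[OF C lin fc] by (simp add: Rf)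
    have "\<exists>c\<in>C. inner v c \<noteq> 0"
    proof (rule ccontr)
      assume "\<not> (\<exists>c\<in>C. inner v c \<noteq> 0)"
      then show False using exp[of v] that by simp
    qed
    then obtain c where "c \<in> C" "inner v c \<noteq> 0"
      by blast
    then show ?thesis
      unfolding eq using pos
      by (intro sum_pos2[OF C(1) \<open>c \<in> C\<close>]) (auto simp: less_imp_le)
  qed
  ultimately have Rpd: "positive_definite R"
    by (simp add: positive_definite_def)
  have RRS: "R ** R = S"
  proof -
    have ff: "f (f c) = S *v c" if "c \<in> C" for c
      using pos[OF that] that by (simp add: fc e linear_cmul[OF lin])
    have "(f \<circ> f) v = S *v v" for v
      by (rule eqI[OF linear_compose[OF lin lin] matrix_vector_linear]) (simp add: ff)
    then have "f (f v) = S *v v" for v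
      by simp
    then have "\<forall>v. (R ** R) *v v = S *v v"
      by (simp only: Rf flip: matrix_vector_mul_assoc) blast
    then show ?thesis
      unfolding matrix_eq .
  qed
  have "R' = R" if R': "positive_definite R'" "R' ** R' = S" for R'
  proof -
    have comm: "f (R' *v v) = R' *v (f v)" for v
    proof (rule eqI[of "\<lambda>v. f (R' *v v)" "\<lambda>v. R' *v (f v)"])
      show "linear (\<lambda>v. f (R' *v v))" "linear (\<lambda>v. R' *v (f v))"
        using linear_compose[OF matrix_vector_linear lin] linear_compose[OF lin matrix_vector_linear]
        by (simp_all add: o_def)
      \<comment> \<open>\<open>R'\<close> commutes with its square \<open>S\<close>, so it preserves
        the eigenspaces of \<open>S\<close>, and on each of them \<open>f\<close> is a
        scalar.\<close>
      fix c assume c: "c \<in> C"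
      have "S *v (R' *v c) = R' *v (S *v c)"
        by (simp add: matrix_vector_mul_assoc matrix_mul_assoc flip: R'(2))
      also have "\<dots> = e c *\<^sub>R (R' *v c)"
        using c by (simp add: e linear_cmul[OF matrix_vector_linear])
      finally show "f (R' *v c) = R' *v f c"
        using c by (simp add: eig fc linear_cmul[OF matrix_vector_linear])
    qed
    have "R' *v v = R *v v" for v
    proof (rule ccontr)
      define w where "w = R' *v v - R *v v"
      assume "R' *v v \<noteq> R *v v"
      then have "w \<noteq> 0" by (simp add: w_def)
      then have "inner w (R' *v w + R *v w) > 0"
        using Rpd R'(1) by (simp add: positive_definite_def inner_add_right add_pos_pos)
      moreover have "R' *v w + R *v w = 0"
      proof -
        have "R' *v (R' *v v) = f (f v)"
          using R'(2) RRS by (metis Rf matrix_vector_mul_assoc)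
        then show ?thesis
          by (simp add: w_def linear_diff[OF matrix_vector_linear] Rf comm linear_diff[OF lin])
      qed
      ultimately show False by simp
    qed
    then show ?thesis by (simp add: matrix_eq)
  qed
  then have "pd_sqrt S = R"
    unfolding pd_sqrt_def using Rpd RRS by blast
  then show "positive_definite (pd_sqrt S)" "pd_sqrt S ** pd_sqrt S = S"
    using Rpd RRS by simp_all
qed

lemma norm_pd_sqrt:
  fixes S :: "'a::star_scalar ^ 'n ^ 'n"
  assumes "positive_definite S" and "eigenvalues_with_mult S l"
  shows "(norm (pd_sqrt S *v v))\<^sup>2 = inner v (S *v v)"
proof -
  have "self_adjoint (pd_sqrt S)"
    using pd_sqrt(1)[OF assms] by (simp add: positive_definite_def)
  from self_adjoint_inner[OF this, of v "pd_sqrt S *v v"] show ?thesis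
    by (simp add: power2_norm_eq_inner matrix_vector_mul_assoc pd_sqrt(2)[OF assms])
qed

section \<open>Quadratic forms of Gaussian vectors\<close>

abbreviation normal_law :: "real \<Rightarrow> real measure" where
  "normal_law \<sigma> \<equiv> density lborel (normal_density 0 \<sigma>)"

lemma integral_iexp_normal_law:
  assumes "\<sigma> > 0"
  shows "(CLINT x|normal_law \<sigma>. iexp (t * x)) = of_real (exp (- (\<sigma>\<^sup>2 * t\<^sup>2 / 2)))"
proof -
  have "(CLINT x|normal_law \<sigma>. iexp (t * x)) = (CLINT x|lborel. normal_density 0 \<sigma> x *\<^sub>R iexp (t * x))"
    by (rule integral_density) (auto simp: normal_density_nonneg)
  also have "\<dots> = \<bar>\<sigma>\<bar> *\<^sub>R (CLINT x|lborel. normal_density 0 \<sigma> (0 + \<sigma> * x) *\<^sub>R iexp (t * (0 + \<sigma> * x)))"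
    using assms by (intro lborel_integral_real_affine) simp
  also have "\<dots> = (CLINT x|lborel. std_normal_density x *\<^sub>R iexp ((\<sigma> * t) * x))"
    using assms
    by (auto simp flip: integral_scaleR_right
        simp: normal_density_def power_mult_distrib real_sqrt_mult mult_ac intro!: Bochner_Integration.integral_cong)
  also have "\<dots> = char std_normal_distribution (\<sigma> * t)"
    unfolding char_def by (rule integral_density[symmetric]) (auto simp: normal_density_nonneg)
  finally show ?thesis
    by (simp add: char_std_normal_distribution power_mult_distrib)
qed

lemma integral_exp_square_std_normal:
  assumes "\<theta> \<ge> 0"
  shows "(LINT x|normal_law 1. exp (- (\<theta> * x\<^sup>2))) = (1 + 2 * \<theta>) powr (- (1 / 2))"
proof -
  have pos: "1 + 2 * \<theta> > 0" using assms by simp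
  have "(LINT x|normal_law 1. exp (- (\<theta> * x\<^sup>2))) = (LINT x|lborel. std_normal_density x *\<^sub>R exp (- (\<theta> * x\<^sup>2)))"
    by (rule integral_density) (auto simp: normal_density_nonneg)
  \<comment> \<open>The two exponentials combine to a Gaussian weight of variance 1 / (1 +
    2\<theta>); the change of normalisation is the power.\<close>
  also have "\<dots> = (LINT x|lborel. (1 + 2 * \<theta>) powr (- (1 / 2)) * normal_density 0 (1 / sqrt (1 + 2 * \<theta>)) x)"
    using pos
    by (intro Bochner_Integration.integral_cong refl)
      (simp add: normal_density_def powr_minus powr_half_sqrt real_sqrt_divide real_sqrt_mult power_divide
        field_simps flip: exp_add)
  also have "\<dots> = (1 + 2 * \<theta>) powr (- (1 / 2))"
    using pos by (simp add: integral_normal_density)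
  finally show ?thesis .
qed

lemma iexp_sum: "finite I \<Longrightarrow> iexp (\<Sum>i\<in>I. f i) = (\<Prod>i\<in>I. iexp (f i))"
  by (simp add: sum_distrib_left exp_sum)

text \<open>
  Each factor \<open>exp (- \<theta> q\<^sup>2)\<close> is the characteristic function of a standard normal variable at
  \<open>sqrt (2 \<theta>) q\<close>. After exchanging the integrals, the integral over \<open>w\<close> depends on the vectors
  \<open>a c\<close> only through their inner products.
\<close>

lemma laplace_transform_gaussian_quadratic_form:
  fixes a :: "'c \<Rightarrow> 'k \<Rightarrow> real"
  assumes fin: "finite C" "finite K" and \<sigma>: "\<sigma> > 0" and \<theta>: "\<And>c. c \<in> C \<Longrightarrow> \<theta> c \<ge> 0"
    and orth: "\<And>c c'. c \<in> C \<Longrightarrow> c' \<in> C \<Longrightarrow> (\<Sum>k\<in>K. a c k * a c' k) = (if c = c' then 1 else 0)"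
  shows "(LINT w|(\<Pi>\<^sub>M k\<in>K. normal_law \<sigma>). exp (- (\<Sum>c\<in>C. \<theta> c * (\<Sum>k\<in>K. a c k * w k)\<^sup>2))) =
    (\<Prod>c\<in>C. (1 + 2 * \<sigma>\<^sup>2 * \<theta> c) powr (- (1 / 2)))"
proof -
  define P where "P = (\<Pi>\<^sub>M c\<in>C. normal_law 1)"
  define Q where "Q = (\<Pi>\<^sub>M k\<in>K. normal_law \<sigma>)"
  have pr: "prob_space (normal_law 1)" "prob_space (normal_law \<sigma>)"
    using \<sigma> by (auto intro: prob_space_normal_density)
  interpret P: product_sigma_finite "\<lambda>_::'c. normal_law 1"
    using pr(1) by (intro product_sigma_finite.intro prob_space_imp_sigma_finite)
  interpret Q: product_sigma_finite "\<lambda>_::'k. normal_law \<sigma>"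
    using pr(2) by (intro product_sigma_finite.intro prob_space_imp_sigma_finite)
  interpret P': prob_space P
    unfolding P_def by (intro prob_space_PiM pr)
  interpret Q': prob_space Q
    unfolding Q_def by (intro prob_space_PiM pr)
  interpret PQ: pair_prob_space P Q ..
  define s where "s c = sqrt (2 * \<theta> c)" for c
  have s2: "(s c)\<^sup>2 = 2 * \<theta> c" if "c \<in> C" for c
    using \<theta>[OF that] by (simp add: s_def)
  \<comment> \<open>The coordinates \<open>h c\<close> are auxiliary independent standard normals
    that linearise the squares. Integrating out \<open>h\<close> gives the quadratic exponential;
    integrating out \<open>w\<close> leaves a Gaussian factor in \<open>h\<close>.\<close>
  define F where "F h w = iexp (\<Sum>c\<in>C. \<Sum>k\<in>K. s c * h c * (a c k * w k))" for h w
  have int_iexp: "integrable (normal_law \<tau>) (\<lambda>x. iexp (t * x))" if "\<tau> > 0" for t \<tau>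
  proof -
    interpret prob_space "normal_law \<tau>"
      using that by (rule prob_space_normal_density)
    show ?thesis
      by (rule integrable_const_bound[where B = 1]) auto
  qed
  have 1: "(CLINT h|P. F h w) = of_real (exp (- (\<Sum>c\<in>C. \<theta> c * (\<Sum>k\<in>K. a c k * w k)\<^sup>2)))" for w
  proof -
    have "(CLINT h|P. F h w) = (CLINT h|P. \<Prod>c\<in>C. iexp ((s c * (\<Sum>k\<in>K. a c k * w k)) * h c))"
      unfolding F_def iexp_sum[OF fin(1)] by (simp add: sum_distrib_left mult_ac)
    also have "\<dots> = (\<Prod>c\<in>C. CLINT x|normal_law 1. iexp ((s c * (\<Sum>k\<in>K. a c k * w k)) * x))"
      unfolding P_def by (intro P.product_integral_prod fin int_iexp) simp
    also have "\<dots> = (\<Prod>c\<in>C. of_real (exp (- (\<theta> c * (\<Sum>k\<in>K. a c k * w k)\<^sup>2))))"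
      by (intro prod.cong refl, subst integral_iexp_normal_law) (simp_all add: power_mult_distrib s2)
    finally show ?thesis
      using fin by (simp add: exp_sum flip: sum_negf of_real_prod)
  qed
  have 2: "(CLINT w|Q. F h w) = of_real (\<Prod>c\<in>C. exp (- (\<sigma>\<^sup>2 * \<theta> c * (h c)\<^sup>2)))" for h
  proof -
    \<comment> \<open>The coefficient of \<open>w k\<close>. Orthonormality makes the sum of the
      \<open>(b k)\<^sup>2\<close> diagonal in \<open>c\<close>, so the coordinates of
      \<open>h\<close> separate.\<close>
    define b where "b k = (\<Sum>c\<in>C. s c * h c * a c k)" for k
    have "(\<Sum>k\<in>K. (b k)\<^sup>2) = (\<Sum>k\<in>K. \<Sum>c\<in>C. \<Sum>c'\<in>C. (s c * h c * (s c' * h c')) * (a c k * a c' k))"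
      by (simp add: b_def power2_eq_square sum_product mult_ac)
    also have "\<dots> = (\<Sum>c\<in>C. \<Sum>c'\<in>C. (s c * h c * (s c' * h c')) * (\<Sum>k\<in>K. a c k * a c' k))"
      by (subst sum.swap, intro sum.cong refl, subst sum.swap) (simp add: sum_distrib_left)
    also have "\<dots> = (\<Sum>c\<in>C. \<Sum>c'\<in>C. if c = c' then (s c * h c * (s c' * h c')) else 0)"
      by (intro sum.cong refl) (simp add: orth)
    also have "\<dots> = (\<Sum>c\<in>C. (s c)\<^sup>2 * (h c)\<^sup>2)"
      using fin by (simp add: power2_eq_square mult_ac)
    also have "\<dots> = (\<Sum>c\<in>C. 2 * \<theta> c * (h c)\<^sup>2)"
      by (intro sum.cong refl) (simp add: s2)
    finally have b2: "(\<Sum>k\<in>K. (b k)\<^sup>2) = (\<Sum>c\<in>C. 2 * \<theta> c * (h c)\<^sup>2)" .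
    have "F h w = iexp (\<Sum>k\<in>K. b k * w k)" for w
      unfolding F_def b_def
      by (subst sum.swap) (simp add: sum_distrib_right sum_distrib_left mult_ac)
    then have "(CLINT w|Q. F h w) = (CLINT w|Q. \<Prod>k\<in>K. iexp (b k * w k))"
      by (simp only: iexp_sum[OF fin(2)])
    also have "\<dots> = (\<Prod>k\<in>K. CLINT x|normal_law \<sigma>. iexp (b k * x))"
      unfolding Q_def by (intro Q.product_integral_prod fin int_iexp \<sigma>)
    also have "\<dots> = (\<Prod>k\<in>K. of_real (exp (- (\<sigma>\<^sup>2 * (b k)\<^sup>2 / 2))))"
      by (intro prod.cong refl integral_iexp_normal_law \<sigma>)
    also have "\<dots> = of_real (exp (- (\<sigma>\<^sup>2 / 2 * (\<Sum>k\<in>K. (b k)\<^sup>2))))"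
      using fin by (simp add: exp_sum sum_distrib_left flip: sum_negf of_real_prod)
    also have "\<dots> = of_real (\<Prod>c\<in>C. exp (- (\<sigma>\<^sup>2 * \<theta> c * (h c)\<^sup>2)))"
      unfolding b2 using fin by (simp add: sum_distrib_left mult_ac flip: exp_sum sum_negf)
    finally show ?thesis .
  qed
  have [measurable]: "(\<lambda>h. h c) \<in> borel_measurable P" if "c \<in> C" for c
    using measurable_component_singleton[OF that, of "\<lambda>_. normal_law 1"] by (simp add: P_def)
  have [measurable]: "(\<lambda>w. w k) \<in> borel_measurable Q" if "k \<in> K" for k
    using measurable_component_singleton[OF that, of "\<lambda>_. normal_law \<sigma>"] by (simp add: Q_def)
  have "(\<lambda>z. F (fst z) (snd z)) \<in> borel_measurable (P \<Otimes>\<^sub>M Q)"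
    unfolding F_def by measurable
  then have "integrable (P \<Otimes>\<^sub>M Q) (\<lambda>(h, w). F h w)"
    by (intro PQ.integrable_const_bound[where B = 1]) (auto simp: F_def case_prod_beta)
  from PQ.Fubini_integral[OF this]
  have "complex_of_real (LINT w|Q. exp (- (\<Sum>c\<in>C. \<theta> c * (\<Sum>k\<in>K. a c k * w k)\<^sup>2))) =
      of_real (LINT h|P. (\<Prod>c\<in>C. exp (- (\<sigma>\<^sup>2 * \<theta> c * (h c)\<^sup>2))))"
    by (simp only: 1 2 integral_complex_of_real)
  also have "(LINT h|P. (\<Prod>c\<in>C. exp (- (\<sigma>\<^sup>2 * \<theta> c * (h c)\<^sup>2)))) =
      (\<Prod>c\<in>C. LINT x|normal_law 1. exp (- (\<sigma>\<^sup>2 * \<theta> c * x\<^sup>2)))"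
    unfolding P_def
  proof (rule P.product_integral_prod[OF fin(1)])
    fix c assume "c \<in> C"
    interpret prob_space "normal_law 1" by fact
    show "integrable (normal_law 1) (\<lambda>x. exp (- (\<sigma>\<^sup>2 * \<theta> c * x\<^sup>2)))"
      using \<theta>[OF \<open>c \<in> C\<close>] by (intro integrable_const_bound[where B = 1]) auto
  qed
  also have "\<dots> = (\<Prod>c\<in>C. (1 + 2 * \<sigma>\<^sup>2 * \<theta> c) powr (- (1 / 2)))"
    using \<theta> by (intro prod.cong refl) (subst integral_exp_square_std_normal, auto simp: mult_ac)
  finally show ?thesis
    unfolding Q_def of_real_eq_iff .
qed

section \<open>An integral representation of the logarithm\<close>

text \<open>
  Substituting \<open>t = x / n\<close> in \<open>harm n = \<integral>\<^sub>0\<^sup>1 (1 - (1 - t)\<^sup>n) / t dt\<close> exhibits \<open>harm n - ln n\<close> as an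
  integral whose integrand converges to the one below.
\<close>

lemma has_bochner_integral_harm_minus_ln:
  assumes "n > 0"
  shows "has_bochner_integral lborel
    (\<lambda>x. indicator {0<..} x *\<^sub>R ((indicator {0..1} x - indicator {..real n} x * (1 - x / n) ^ n) / x))
    (harm n - ln (real n))" (is "has_bochner_integral _ ?g _")
proof -
  \<comment> \<open>This is \<open>(1 - (1 - x / n) ^ n) / x\<close> as a geometric sum, with no
    singularity at 0 and an explicit antiderivative.\<close>
  let ?p = "\<lambda>x::real. (\<Sum>k<n. (1 - x / n) ^ k) / n"
  let ?P = "\<lambda>x::real. - (\<Sum>k<n. (1 - x / n) ^ Suc k / real (Suc k))"
  have "has_bochner_integral lborel (\<lambda>x. ?p x * indicator {0..real n} x) (?P n - ?P 0)"
  proof (rule has_bochner_integral_FTC_Icc_real)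
    show "DERIV ?P x :> ?p x" for x
      using assms by (auto intro!: derivative_eq_intros sum.cong simp: sum_divide_distrib sum_negf[symmetric]
          simp del: power_Suc of_nat_Suc)
  qed (use assms in \<open>auto intro!: continuous_intros\<close>)
  also have "?P n - ?P 0 = harm n"
    using assms by (simp add: harm_altdef divide_inverse)
  finally have 1: "has_bochner_integral lborel (\<lambda>x. ?p x * indicator {0..real n} x) (harm n)" .
  \<comment> \<open>Beyond 1 the target integrand lacks the term \<open>1 / x\<close> contained in
    \<open>?p\<close>; removing it up to \<open>n\<close> produces \<open>ln n\<close>.\<close>
  have 2: "has_bochner_integral lborel (\<lambda>x. (1 / x) * indicator {1..real n} x) (ln n - ln 1)"
    using assms by (intro has_bochner_integral_FTC_Icc_real) (auto intro!: derivative_eq_intros continuous_intros)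
  have 3: "AE x in lborel. x \<noteq> 0 \<and> x \<noteq> (1::real)"
    by (intro AE_conjI AE_lborel_singleton)
  show ?thesis
  proof (rule has_bochner_integralI_AE[OF has_bochner_integral_diff[OF 1 2[simplified ln_one diff_zero]]])
    show "AE x in lborel. ?p x * indicator {0..real n} x - 1 / x * indicator {1..real n} x = ?g x"
      using 3
    proof eventually_elim
      case (elim x)
      have "(1 - (1 - x / n) ^ n) / x = ?p x"
      proof -
        have "1 - (1 - x / n) ^ n = (x / n) * (\<Sum>k<n. (1 - x / n) ^ k)"
          using one_diff_power_eq[of "1 - x / n" n] by simp
        then show ?thesis using elim by simp
      qed
      then have p: "?p x = 1 / x - (1 - x / n) ^ n / x"
        by (simp add: diff_divide_distrib)
      show ?case
        unfolding p using elim assms by (auto split: split_indicator simp: field_simps)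
    qed
  qed measurable
qed

definition frullani_kernel :: "real \<Rightarrow> real \<Rightarrow> real" where
  "frullani_kernel w x = indicator {0<..} x *\<^sub>R ((indicator {0..1} x - exp (- (x * w))) / x)"

lemma frullani_kernel_1:
  "has_bochner_integral lborel (frullani_kernel 1) euler_mascheroni"
proof -
  define g where "g n x = indicator {0<..} x *\<^sub>R
    ((indicator {0..1} x - indicator {..real (Suc n)} x * (1 - x / real (Suc n)) ^ Suc n) / x)" for n x
  have g: "has_bochner_integral lborel (g n) (harm (Suc n) - ln (real (Suc n)))" for n
    unfolding g_def by (rule has_bochner_integral_harm_minus_ln) simp
  \<comment> \<open>With N = \<open>Suc n\<close>: on (0, 1] Bernoulli's inequality gives
    \<open>1 - x \<le> (1 - x / N) ^ N \<le> 1\<close>, so the quotient lies in [0, 1]; past 1,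
    \<open>(1 - x / N) ^ N \<le> exp (- x)\<close> and dividing by \<open>x\<close> only
    helps.\<close>
  define b where "b x = indicator {0..1} x + indicator {1..} x * exp (- x)" for x :: real
  have lim: "(\<lambda>n. g n x) \<longlonglongrightarrow> frullani_kernel 1 x" for x
  proof -
    have "eventually (\<lambda>n. real (Suc n) \<ge> x) sequentially"
      using eventually_ge_at_top[of "nat \<lceil>x\<rceil>"] by eventually_elim linarith
    then have 1: "eventually (\<lambda>n. (1 - x / real (Suc n)) ^ Suc n = indicator {..real (Suc n)} x * (1 - x / real (Suc n)) ^ Suc n) sequentially"
      by eventually_elim (simp add: indicator_def)
    have "(\<lambda>n. (1 + (- x) / real (Suc n)) ^ Suc n) \<longlonglongrightarrow> exp (- x)"
      by (rule LIMSEQ_Suc[OF tendsto_exp_limit_sequentially])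
    then have "(\<lambda>n. (1 - x / real (Suc n)) ^ Suc n) \<longlonglongrightarrow> exp (- x)"
      by simp
    from Lim_transform_eventually[OF this 1] show ?thesis
      unfolding g_def frullani_kernel_def
      by (cases "x = 0") (auto intro!: tendsto_intros simp del: of_nat_Suc power_Suc)
  qed
  have bound: "norm (g n x) \<le> b x" for n x
  proof (cases "x > 0")
    case True
    let ?e = "(1 - x / real (Suc n)) ^ Suc n"
    show ?thesis
    proof (cases "x \<le> 1")
      case x1: True
      have ge: "1 - x \<le> ?e"
      proof -
        have "-1 \<le> - x / real (Suc n)"
          using x1 True by (simp add: field_simps)
        from Bernoulli_inequality[OF this, of "Suc n"]
        have "1 + real (Suc n) * (- x / real (Suc n)) \<le> ?e"
          by (simp del: power_Suc of_nat_Suc)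
        then show ?thesis
          by (simp del: power_Suc)
      qed
      have "?e \<le> 1"
        using x1 True by (intro power_le_one) (auto simp: field_simps)
      with ge have "\<bar>(1 - ?e) / x\<bar> \<le> 1"
        using True by (simp add: field_simps del: power_Suc of_nat_Suc)
      moreover have "norm (g n x) = \<bar>(1 - ?e) / x\<bar>"
        using True x1 by (simp add: g_def indicator_def del: power_Suc of_nat_Suc)
      moreover have "1 \<le> b x"
        using True x1 by (simp add: b_def indicator_def)
      ultimately show ?thesis
        by linarith
    next
      case False
      show ?thesis
      proof (cases "x \<le> real (Suc n)")
        case xn: True
        have "?e \<le> exp (- x)"
          by (rule exp_ge_one_minus_x_over_n_power_n) (use xn in auto)
        moreover have "0 \<le> ?e"
          using xn True by (intro zero_le_power) (auto simp: field_simps)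
        ultimately have "?e / x \<le> exp (- x) / 1" "0 \<le> ?e / x"
          using False by (intro frac_le, auto simp del: power_Suc)
        then show ?thesis
          using True False xn by (auto simp: g_def b_def indicator_def simp del: power_Suc of_nat_Suc)
      next
        case False
        then show ?thesis
          using \<open>\<not> x \<le> 1\<close> by (simp add: g_def b_def del: power_Suc of_nat_Suc)
      qed
    qed
  qed (simp add: g_def b_def)
  have int_exp: "integrable lborel (\<lambda>x::real. indicator {1..} x * exp (- x))"
  proof (rule integrableI_nonneg)
    have "(\<integral>\<^sup>+x. ennreal (indicator {1..} x * exp (- 1 * x)) \<partial>lborel) = ennreal (exp (- 1 * 1) / 1)"
      by (rule nn_integral_has_integral_lebesgue[OF _ has_integral_exp_minus_to_infinity]) auto
    then show "(\<integral>\<^sup>+x. ennreal (indicator {1..} x * exp (- x)) \<partial>lborel) < \<infinity>"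
      by simp
  qed auto
  have int_b: "integrable lborel b"
    unfolding b_def using int_exp by (intro Bochner_Integration.integrable_add) auto
  have meas: "g n \<in> borel_measurable lborel" "frullani_kernel 1 \<in> borel_measurable lborel" for n
    unfolding g_def[abs_def] frullani_kernel_def[abs_def] by measurable
  note * = meas(2) meas(1) int_b AE_I2[OF lim] AE_I2[OF bound]
  have "(\<lambda>n. harm (Suc n) - ln (real (Suc n))) \<longlonglongrightarrow> integral\<^sup>L lborel (frullani_kernel 1)"
    using integral_dominated_convergence[OF *] by (simp only: has_bochner_integral_integral_eq[OF g])
  moreover have "(\<lambda>n. harm (Suc n) - ln (real (Suc n)) :: real) \<longlonglongrightarrow> euler_mascheroni"
    by (rule LIMSEQ_Suc[OF euler_mascheroni_LIMSEQ])
  ultimately have "integral\<^sup>L lborel (frullani_kernel 1) = euler_mascheroni"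
    by (rule LIMSEQ_unique)
  with integrable_dominated_convergence[OF *] show ?thesis
    by (simp add: has_bochner_integral_iff)
qed

text \<open>The integrand is \<open>1 / x\<close> between 1 and \<open>1 / w\<close>, with constant
  sign. It is the correction for moving the cutoff of the Frullani kernel from \<open>1 / w\<close>
  to 1.\<close>

lemma has_bochner_integral_log_kernel:
  fixes w :: real
  assumes "w > 0"
  shows "has_bochner_integral lborel (\<lambda>x. (indicator {0<..1} x - indicator {0<..1/w} x) / x) (ln w)"
    and "(LINT x|lborel. \<bar>(indicator {0<..1} x - indicator {0<..1/w} x) / x\<bar>) = \<bar>ln w\<bar>"
proof -
  define v where "v = 1 / w"
  have v: "v > 0" "w = 1 / v"
    using assms by (simp_all add: v_def)
  let ?k = "\<lambda>x. (indicator {0<..1} x - indicator {0<..v} x) / x"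
  have ae: "AE x in lborel. x \<noteq> 1 \<and> x \<noteq> v"
    by (intro AE_conjI AE_lborel_singleton)
  have fin: "has_bochner_integral lborel (\<lambda>x. (1 / x) * indicator {a..b} x) (ln b - ln a)"
    if "0 < a" "a \<le> b" for a b :: real
    using that by (intro has_bochner_integral_FTC_Icc_real) (auto intro!: derivative_eq_intros continuous_intros)
  have "has_bochner_integral lborel ?k (ln w) \<and> has_bochner_integral lborel (\<lambda>x. \<bar>?k x\<bar>) \<bar>ln w\<bar>"
  proof (cases "v \<le> 1")
    case True
    have *: "has_bochner_integral lborel (\<lambda>x. (1 / x) * indicator {v..1} x) (ln w)"
      using fin[of v 1] True v by (simp add: ln_div)
    have ae1: "AE x in lborel. (1 / x) * indicator {v..1} x = ?k x"
      using ae by eventually_elim (use v(1) True in \<open>auto split: split_indicator\<close>)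
    have ae2: "AE x in lborel. (1 / x) * indicator {v..1} x = \<bar>?k x\<bar>"
      using ae by eventually_elim (use v(1) True in \<open>auto split: split_indicator\<close>)
    have eq: "\<bar>ln w\<bar> = ln w"
      using True v by (simp add: ln_div)
    have "has_bochner_integral lborel ?k (ln w)"
      by (rule has_bochner_integralI_AE[OF * _ ae1]) measurable
    moreover have "has_bochner_integral lborel (\<lambda>x. \<bar>?k x\<bar>) (ln w)"
      by (rule has_bochner_integralI_AE[OF * _ ae2]) measurable
    ultimately show ?thesis
      unfolding eq by (rule conjI)
  next
    case False
    have *: "has_bochner_integral lborel (\<lambda>x. (1 / x) * indicator {1..v} x) (- ln w)"
      using fin[of 1 v] False v by (simp add: ln_div)
    have ae1: "AE x in lborel. - ((1 / x) * indicator {1..v} x) = ?k x"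
      using ae by eventually_elim (use v(1) False in \<open>auto split: split_indicator\<close>)
    have ae2: "AE x in lborel. (1 / x) * indicator {1..v} x = \<bar>?k x\<bar>"
      using ae by eventually_elim (use v(1) False in \<open>auto split: split_indicator\<close>)
    have eq: "\<bar>ln w\<bar> = - ln w"
      using False v by (simp add: ln_div)
    have "has_bochner_integral lborel ?k (- (- ln w))"
      by (rule has_bochner_integralI_AE[OF has_bochner_integral_minus[OF *] _ ae1]) measurable
    moreover have "has_bochner_integral lborel (\<lambda>x. \<bar>?k x\<bar>) (- ln w)"
      by (rule has_bochner_integralI_AE[OF * _ ae2]) measurable
    ultimately show ?thesis
      unfolding eq minus_minus by (rule conjI)
  qed
  then show "has_bochner_integral lborel (\<lambda>x. (indicator {0<..1} x - indicator {0<..1/w} x) / x) (ln w)"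
      "(LINT x|lborel. \<bar>(indicator {0<..1} x - indicator {0<..1/w} x) / x\<bar>) = \<bar>ln w\<bar>"
    by (auto simp: has_bochner_integral_integral_eq simp flip: v_def)
qed

text \<open>The substitution \<open>x \<mapsto> w * x\<close> preserves \<open>dx / x\<close> but
  displaces the cutoff, which costs \<open>ln w\<close>. The bound on the absolute integral is what
  Fubini needs once \<open>w\<close> becomes random.\<close>

lemma frullani_kernel_integral:
  assumes w: "w > 0"
  shows "has_bochner_integral lborel (frullani_kernel w) (euler_mascheroni + ln w)"
    and "(LINT x|lborel. \<bar>frullani_kernel w x\<bar>) \<le> (LINT x|lborel. \<bar>frullani_kernel 1 x\<bar>) + \<bar>ln w\<bar>"
proof -
  let ?k = "\<lambda>x. (indicator {0<..1} x - indicator {0<..1/w} x) / x"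
  have eq: "frullani_kernel w x = w * frullani_kernel 1 (w * x) + ?k x" for x
    using w by (auto simp: frullani_kernel_def zero_less_mult_iff field_simps split: split_indicator)
  have int1: "integrable lborel (frullani_kernel 1)"
    using frullani_kernel_1 by (simp add: has_bochner_integral_iff)
  have scale: "has_bochner_integral lborel (\<lambda>x. w * frullani_kernel 1 (w * x)) euler_mascheroni"
    using lborel_integral_real_affine[of w "frullani_kernel 1" 0]
      lborel_integrable_real_affine[OF int1, of w 0] frullani_kernel_1 w
    by (simp add: has_bochner_integral_iff)
  note k = has_bochner_integral_log_kernel[OF w]
  show *: "has_bochner_integral lborel (frullani_kernel w) (euler_mascheroni + ln w)"
    unfolding eq[abs_def] by (rule has_bochner_integral_add[OF scale k(1)])
  have int: "integrable lborel (\<lambda>x. w * frullani_kernel 1 (w * x))" "integrable lborel ?k"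
      "integrable lborel (frullani_kernel w)"
    using scale k(1) * by (simp_all add: has_bochner_integral_iff)
  have "(LINT x|lborel. \<bar>frullani_kernel w x\<bar>) \<le>
      (LINT x|lborel. \<bar>w * frullani_kernel 1 (w * x)\<bar> + \<bar>?k x\<bar>)"
  proof (rule integral_mono)
    show "\<bar>frullani_kernel w x\<bar> \<le> \<bar>w * frullani_kernel 1 (w * x)\<bar> + \<bar>?k x\<bar>" for x
      unfolding eq by (rule abs_triangle_ineq)
  qed (intro Bochner_Integration.integrable_add integrable_abs int)+
  also have "\<dots> = (LINT x|lborel. \<bar>w * frullani_kernel 1 (w * x)\<bar>) + (LINT x|lborel. \<bar>?k x\<bar>)"
    using int by (intro Bochner_Integration.integral_add integrable_abs)
  also have "(LINT x|lborel. \<bar>w * frullani_kernel 1 (w * x)\<bar>) = (LINT x|lborel. \<bar>frullani_kernel 1 x\<bar>)"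
    using lborel_integral_real_affine[of w "\<lambda>x. \<bar>frullani_kernel 1 x\<bar>" 0] w by (simp add: abs_mult)
  finally show "(LINT x|lborel. \<bar>frullani_kernel w x\<bar>) \<le> (LINT x|lborel. \<bar>frullani_kernel 1 x\<bar>) + \<bar>ln w\<bar>"
    using k(2) by simp
qed

section \<open>Integrals against powers over the positive half-line\<close>

lemma nn_integral_finite_powr_bounds:
  fixes f :: "real \<Rightarrow> real"
  assumes "p > -1" "q < -1" and C: "C \<ge> 0"
    and f: "\<And>x. 0 < x \<Longrightarrow> x \<le> 1 \<Longrightarrow> f x \<le> C * x powr p" "\<And>x. 1 < x \<Longrightarrow> f x \<le> C * x powr q"
  shows "(\<integral>\<^sup>+x\<in>{0<..}. ennreal (f x) \<partial>lborel) < \<infinity>"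
proof -
  have p: "(\<integral>\<^sup>+x. ennreal (x powr p) * indicator {0..1} x \<partial>lborel) = ennreal (1 / (p + 1))"
    using nn_integral_has_integral_lebesgue'[OF _ has_integral_powr_from_0[of p 1]] assms by simp
  have q: "(\<integral>\<^sup>+x. ennreal (x powr q) * indicator {1..} x \<partial>lborel) = ennreal (- 1 / (q + 1))"
    using nn_integral_has_integral_lebesgue'[OF _ has_integral_powr_to_inf[of q 1]] assms by simp
  have "(\<integral>\<^sup>+x\<in>{0<..}. ennreal (f x) \<partial>lborel) \<le>
      (\<integral>\<^sup>+x. ennreal C * (ennreal (x powr p) * indicator {0..1} x + ennreal (x powr q) * indicator {1..} x) \<partial>lborel)"
  proof (rule nn_integral_mono)
    fix x :: real
    show "ennreal (f x) * indicator {0<..} x \<le>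
        ennreal C * (ennreal (x powr p) * indicator {0..1} x + ennreal (x powr q) * indicator {1..} x)"
      using f[of x] C
      by (cases "x \<le> 0"; cases "x \<le> 1")
        (auto simp: distrib_left ennreal_mult' [symmetric] intro!: ennreal_leI add_increasing2
          split: split_indicator)
  qed
  also have "\<dots> = ennreal C * (ennreal (1 / (p + 1)) + ennreal (- 1 / (q + 1)))"
    by (simp add: nn_integral_cmult nn_integral_add p q)
  also have "\<dots> < \<infinity>"
    by (simp add: ennreal_mult_less_top)
  finally show ?thesis .
qed

lemma nn_integral_scale_powr:
  fixes \<phi> :: "real \<Rightarrow> real"
  assumes [measurable]: "\<phi> \<in> borel_measurable borel" and w: "w > 0" and \<phi>: "\<And>x. x > 0 \<Longrightarrow> \<phi> x \<ge> 0"
  shows "(\<integral>\<^sup>+x\<in>{0<..}. ennreal (\<phi> (x * w) * x powr (- s - 1)) \<partial>lborel) =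
    ennreal (w powr s) * (\<integral>\<^sup>+x\<in>{0<..}. ennreal (\<phi> x * x powr (- s - 1)) \<partial>lborel)"
proof -
  have scale: "(\<integral>\<^sup>+x\<in>{0<..}. ennreal (\<phi> x * x powr (- s - 1)) \<partial>lborel) =
      ennreal \<bar>w\<bar> * (\<integral>\<^sup>+x. ennreal (\<phi> (0 + w * x) * (0 + w * x) powr (- s - 1)) * indicator {0<..} (0 + w * x) \<partial>lborel)"
    using w by (intro nn_integral_real_affine) auto
  have "ennreal (w powr s) * (\<integral>\<^sup>+x\<in>{0<..}. ennreal (\<phi> x * x powr (- s - 1)) \<partial>lborel) =
      (\<integral>\<^sup>+x. ennreal (w powr s) * (ennreal \<bar>w\<bar> * (ennreal (\<phi> (0 + w * x) * (0 + w * x) powr (- s - 1)) * indicator {0<..} (0 + w * x))) \<partial>lborel)"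
    unfolding scale by (simp add: nn_integral_cmult)
  also have "\<dots> = (\<integral>\<^sup>+x\<in>{0<..}. ennreal (\<phi> (x * w) * x powr (- s - 1)) \<partial>lborel)"
  proof (rule nn_integral_cong)
    fix x :: real
    show "ennreal (w powr s) * (ennreal \<bar>w\<bar> * (ennreal (\<phi> (0 + w * x) * (0 + w * x) powr (- s - 1)) * indicator {0<..} (0 + w * x))) =
      ennreal (\<phi> (x * w) * x powr (- s - 1)) * indicator {0<..} x"
    proof (cases "x > 0")
      case True
      have "(w * x) powr (- s - 1) = w powr (- s - 1) * x powr (- s - 1)"
        by (rule powr_mult)
      moreover have "w powr 1 = w"
        using w by simp
      ultimately have "w powr s * (w * (\<phi> (w * x) * (w * x) powr (- s - 1))) = \<phi> (x * w) * x powr (- s - 1) * (w powr s * w powr 1 * w powr (- s - 1))"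
        by (simp only: mult_ac)
      also have "w powr s * w powr 1 * w powr (- s - 1) = w powr (s + 1 + (- s - 1))"
        by (simp only: powr_add)
      also have "\<dots> = 1"
        using w by simp
      finally show ?thesis
        using w True \<phi>[of "x * w"] by (simp add: mult.commute flip: ennreal_mult')
    qed (use w in \<open>simp add: zero_less_mult_iff indicator_def\<close>)
  qed
  finally show ?thesis by simp
qed

section \<open>Laws with a product Laplace transform\<close>

text \<open>For positive \<open>m\<close> and \<open>y i\<close>, the Laplace transform of a sum of
  independent Gamma variables of shape \<open>m\<close> and rates \<open>y i\<close>.\<close>

definition product_transform :: "('n::finite \<Rightarrow> real) \<Rightarrow> real \<Rightarrow> real \<Rightarrow> real" where
  "product_transform y m x = (\<Prod>i\<in>UNIV. (1 + x / y i) powr (- m))"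

lemma product_transform_measurable [measurable]: "product_transform y m \<in> borel_measurable borel"
  unfolding product_transform_def[abs_def] by measurable

text \<open>The linear bound controls the behaviour at 0 and follows factorwise from
  \<open>ln (1 + t) \<le> t\<close>. The decay at infinity keeps a single factor and uses only
  \<open>m \<ge> 1 / 2\<close>, the worst case being one real dimension.\<close>

lemma product_transform_bounds:
  fixes y :: "'n::finite \<Rightarrow> real"
  assumes y: "\<And>i. y i > 0" and m: "m \<ge> 1 / 2" and x: "x > 0"
  shows "product_transform y m x \<ge> 0" "product_transform y m x \<le> 1"
    "1 - product_transform y m x \<le> (\<Sum>i\<in>UNIV. m / y i) * x"
    "product_transform y m x \<le> y i powr (1 / 2) * x powr (- (1 / 2))"
proof -
  have base: "1 + x / y i \<ge> 1" for i
    using y[of i] x by simp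
  have f: "(1 + x / y i) powr (- m) \<ge> 0" "(1 + x / y i) powr (- m) \<le> 1" for i
    using base[of i] m powr_mono[of "- m" 0 "1 + x / y i"] by simp_all
  show "product_transform y m x \<ge> 0"
    unfolding product_transform_def by (intro prod_nonneg) (simp add: f)
  show "product_transform y m x \<le> 1"
    unfolding product_transform_def using f by (intro prod_le_1) auto
  have "1 - (\<Sum>i\<in>UNIV. m / y i) * x \<le> exp (- ((\<Sum>i\<in>UNIV. m / y i) * x))"
    using exp_ge_add_one_self[of "- ((\<Sum>i\<in>UNIV. m / y i) * x)"] by simp
  also have "\<dots> = (\<Prod>i\<in>UNIV. exp (- (m * (x / y i))))"
    by (simp add: sum_distrib_left sum_negf mult_ac flip: exp_sum)
  also have "\<dots> \<le> product_transform y m x"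
    unfolding product_transform_def
  proof (intro prod_mono conjI)
    fix i
    have "m * ln (1 + x / y i) \<le> m * (x / y i)"
      using m x y[of i] by (intro mult_left_mono ln_add_one_self_le_self) auto
    then show "exp (- (m * (x / y i))) \<le> (1 + x / y i) powr (- m)"
      using base[of i] by (simp add: powr_def)
  qed simp
  finally show "1 - product_transform y m x \<le> (\<Sum>i\<in>UNIV. m / y i) * x"
    by simp
  have "product_transform y m x = (1 + x / y i) powr (- m) * (\<Prod>j\<in>UNIV - {i}. (1 + x / y j) powr (- m))"
    unfolding product_transform_def by (simp add: prod.remove)
  also have "\<dots> \<le> (1 + x / y i) powr (- m) * 1"
    using f by (intro mult_left_mono prod_le_1) auto
  also have "\<dots> \<le> (1 + x / y i) powr (- (1 / 2))"
    using base[of i] m by (simp add: powr_mono)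
  also have "\<dots> \<le> (x / y i) powr (- (1 / 2))"
    using y[of i] x by (intro powr_mono2') auto
  also have "\<dots> = y i powr (1 / 2) * x powr (- (1 / 2))"
    using y[of i] x by (simp add: powr_divide powr_minus_divide)
  finally show "product_transform y m x \<le> y i powr (1 / 2) * x powr (- (1 / 2))" .
qed

text \<open>The classical Mellin transform at \<open>- s\<close>, taken in \<open>ennreal\<close> so
  that Tonelli and scaling apply before finiteness is known.\<close>

definition mellin :: "(real \<Rightarrow> real) \<Rightarrow> real \<Rightarrow> ennreal" where
  "mellin \<phi> s = (\<integral>\<^sup>+x\<in>{0<..}. ennreal (\<phi> x * x powr (- s - 1)) \<partial>lborel)"

text \<open>
  By scaling, \<open>w powr s\<close> is a constant multiple of the integral over \<open>x > 0\<close> of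
  \<open>\<phi> (x * w) * x powr (- s - 1)\<close>. For \<open>s < 0\<close> this converges with \<open>\<phi> x = exp (- x)\<close>, for
  \<open>0 < s < 1\<close> with \<open>\<phi> x = 1 - exp (- x)\<close>, so a Laplace transform determines small moments of
  both signs.
\<close>

definition power_kernel :: "real \<Rightarrow> (real \<Rightarrow> real) \<Rightarrow> real \<Rightarrow> real" where
  "power_kernel s \<phi> x = (if s < 0 then \<phi> x else 1 - \<phi> x)"

lemma power_kernel_measurable [measurable]:
  "\<phi> \<in> borel_measurable borel \<Longrightarrow> power_kernel s \<phi> \<in> borel_measurable borel"
  by (cases "s < 0") (simp_all add: power_kernel_def[abs_def])

text \<open>For \<open>s < 0\<close> the integrand is bounded by multiples of
  \<open>x powr (- s - 1)\<close> near 0 and \<open>x powr (- s - 3 / 2)\<close> at infinity, and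
  the latter forces \<open>s > - 1 / 2\<close>. For \<open>s > 0\<close> the exponents are
  \<open>- s\<close> and \<open>- s - 1\<close>, where \<open>s < 1\<close> would do.\<close>

lemma mellin_power_kernel_finite:
  assumes s: "s \<noteq> 0" "\<bar>s\<bar> < 1 / 2"
    and \<phi>: "\<And>x. x > 0 \<Longrightarrow> \<phi> x \<ge> 0" "\<And>x. x > 0 \<Longrightarrow> \<phi> x \<le> 1"
    and C: "\<And>x. x > 0 \<Longrightarrow> 1 - \<phi> x \<le> C * x" "\<And>x. x > 0 \<Longrightarrow> \<phi> x \<le> C * x powr (- (1 / 2))"
  shows "mellin (power_kernel s \<phi>) s < \<infinity>"
proof (cases "s < 0")
  case True
  have "C \<ge> 0" using C(2)[of 1] \<phi>(1)[of 1] by simp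
  show ?thesis
    unfolding mellin_def
  proof (rule nn_integral_finite_powr_bounds[of "- s - 1" "- s - 3 / 2" "max 1 C"])
    fix x :: real
    show "power_kernel s \<phi> x * x powr (- s - 1) \<le> max 1 C * x powr (- s - 1)" if "0 < x" "x \<le> 1"
      using \<phi>[of x] that True by (intro mult_right_mono) (auto simp: power_kernel_def)
    show "power_kernel s \<phi> x * x powr (- s - 1) \<le> max 1 C * x powr (- s - 3 / 2)" if "1 < x"
    proof -
      have "power_kernel s \<phi> x * x powr (- s - 1) \<le> C * x powr (- (1 / 2)) * x powr (- s - 1)"
        using C(2)[of x] that True by (intro mult_right_mono) (auto simp: power_kernel_def)
      also have "\<dots> = C * x powr (- s - 3 / 2)"
        by (simp add: mult.assoc algebra_simps flip: powr_add)
      also have "\<dots> \<le> max 1 C * x powr (- s - 3 / 2)"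
        by (intro mult_right_mono) auto
      finally show ?thesis .
    qed
  qed (use s True in \<open>linarith | simp\<close>)+
next
  case False
  show ?thesis
    unfolding mellin_def
  proof (rule nn_integral_finite_powr_bounds[of "- s" "- s - 1" "max 1 C"])
    fix x :: real
    show "power_kernel s \<phi> x * x powr (- s - 1) \<le> max 1 C * x powr (- s - 1)" if "1 < x"
      using \<phi>[of x] that False by (intro mult_right_mono) (auto simp: power_kernel_def)
    show "power_kernel s \<phi> x * x powr (- s - 1) \<le> max 1 C * x powr (- s)" if "0 < x" "x \<le> 1"
    proof -
      have "power_kernel s \<phi> x * x powr (- s - 1) \<le> C * x * x powr (- s - 1)"
        using C(1)[of x] that False by (intro mult_right_mono) (auto simp: power_kernel_def)
      also have "\<dots> = C * x powr (- s)"
        using that powr_add[of x 1 "- s - 1"] by simp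
      also have "\<dots> \<le> max 1 C * x powr (- s)"
        by (intro mult_right_mono) auto
      finally show ?thesis .
    qed
  qed (use s False in \<open>linarith | simp\<close>)+
qed

text \<open>The value is \<Gamma>(-s) for negative \<open>s\<close> and \<Gamma>(1-s)/s for positive
  \<open>s\<close>. Only that it is neither 0 nor infinite matters, because it is divided
  out.\<close>

lemma mellin_power_kernel_exp:
  assumes "s \<noteq> 0" "\<bar>s\<bar> < 1 / 2"
  shows "mellin (power_kernel s (\<lambda>x. exp (- x))) s < \<infinity>" "mellin (power_kernel s (\<lambda>x. exp (- x))) s \<noteq> 0"
proof -
  show "mellin (power_kernel s (\<lambda>x. exp (- x))) s < \<infinity>"
  proof (rule mellin_power_kernel_finite[OF assms, of _ 1])
    fix x :: real assume x: "x > 0"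
    show "1 - exp (- x) \<le> 1 * x"
      using exp_ge_add_one_self[of "- x"] by simp
    have "x powr (1 / 2) = exp (ln x / 2)"
      using x by (simp add: powr_def)
    also have "\<dots> \<le> exp x"
      using ln_le_minus_one[OF x] x by simp
    finally show "exp (- x) \<le> 1 * x powr (- (1 / 2))"
      using x by (simp add: exp_minus powr_minus le_imp_inverse_le)
  qed (use assms in auto)
  show "mellin (power_kernel s (\<lambda>x. exp (- x))) s \<noteq> 0"
  proof
    assume "mellin (power_kernel s (\<lambda>x. exp (- x))) s = 0"
    then have "AE x in lborel. ennreal (power_kernel s (\<lambda>x. exp (- x)) x * x powr (- s - 1)) * indicator {0<..} x = 0"
      unfolding mellin_def by (subst (asm) nn_integral_0_iff_AE) simp_all
    then have "AE x in lborel. x \<notin> {0<..1::real}"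
    proof eventually_elim
      case (elim x)
      show ?case
      proof
        assume "x \<in> {0<..1}"
        then have "power_kernel s (\<lambda>x. exp (- x)) x * x powr (- s - 1) > 0"
          by (intro mult_pos_pos) (auto simp: power_kernel_def)
        then show False
          using elim \<open>x \<in> {0<..1}\<close> by (auto simp: indicator_def)
      qed
    qed
    then have "emeasure lborel {x::real. 0 < x \<and> x \<le> 1} = 0"
      by (subst (asm) AE_iff_measurable[OF _ refl]) auto
    moreover have "{x::real. 0 < x \<and> x \<le> 1} = {0<..1}"
      by auto
    ultimately show False by simp
  qed
qed

text \<open>Nothing but the transform of \<open>W\<close> is assumed, so every consequence holds
  alike for all unit vectors \<open>u\<close> when \<open>W\<close> is
  \<open>(\<beta>/2) |A u|\<^sup>2\<close>.\<close>

locale product_laplace_law = prob_space M for M :: "'w measure" +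
  fixes W :: "'w \<Rightarrow> real" and y :: "'n::finite \<Rightarrow> real" and m :: real
  assumes W_measurable [measurable]: "W \<in> borel_measurable M"
    and W_nonneg: "\<And>\<omega>. W \<omega> \<ge> 0"
    and y_pos: "\<And>i. y i > 0"
    and m_ge: "m \<ge> 1 / 2"
    and laplace: "\<And>x. x > 0 \<Longrightarrow> expectation (\<lambda>\<omega>. exp (- (x * W \<omega>))) = product_transform y m x"
begin

lemmas transform_bounds = product_transform_bounds[OF y_pos m_ge]

lemma integrable_exp: "x > 0 \<Longrightarrow> integrable M (\<lambda>\<omega>. exp (- (x * W \<omega>)))"
  using W_nonneg by (intro integrable_const_bound[where B = 1]) auto

text \<open>The probability of \<open>W = 0\<close> is at most the transform at every
  \<open>x > 0\<close>, which tends to 0 at infinity. This makes logarithms and negative powers of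
  \<open>W\<close> meaningful despite the conventions at 0.\<close>

lemma AE_pos: "AE \<omega> in M. W \<omega> > 0"
proof -
  have "prob {\<omega> \<in> space M. W \<omega> = 0} \<le> y i powr (1 / 2) * x powr (- (1 / 2))" if "x > 0" for x i
  proof -
    have "prob {\<omega> \<in> space M. W \<omega> = 0} = expectation (indicator {\<omega> \<in> space M. W \<omega> = 0})"
      by (simp add: Int_absorb2)
    also have "\<dots> \<le> expectation (\<lambda>\<omega>. exp (- (x * W \<omega>)))"
      using that
      by (intro integral_mono integrable_exp integrable_const_bound[where B = 1]) (auto split: split_indicator)
    also have "\<dots> \<le> y i powr (1 / 2) * x powr (- (1 / 2))"
      using laplace transform_bounds(4) that by simp
    finally show ?thesis .
  qed
  \<comment> \<open>\<open>undefined\<close> is an arbitrary index; the decay of any one factor is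
    enough.\<close>
  then have "eventually (\<lambda>x. prob {\<omega> \<in> space M. W \<omega> = 0} \<le> y undefined powr (1 / 2) * x powr (- (1 / 2))) at_top"
    using eventually_gt_at_top[of 0] by (rule eventually_mono[rotated])
  moreover have "((\<lambda>x. y undefined powr (1 / 2) * x powr (- (1 / 2))) \<longlongrightarrow> y undefined powr (1 / 2) * 0) at_top"
    by (intro tendsto_intros tendsto_neg_powr filterlim_ident) auto
  ultimately have "prob {\<omega> \<in> space M. W \<omega> = 0} \<le> 0"
    by (intro tendsto_lowerbound) auto
  then have "emeasure M {\<omega> \<in> space M. W \<omega> = 0} = 0"
    by (simp add: emeasure_eq_measure measure_le_0_iff)
  then have "AE \<omega> in M. W \<omega> \<noteq> 0"
    by (subst AE_iff_measurable[OF _ refl]) auto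
  then show ?thesis
    by eventually_elim (use W_nonneg in \<open>simp add: less_le\<close>)
qed

text \<open>Tonelli, with scaling on one side and the Laplace transform on the other. The right-hand
  side involves only \<open>y\<close>, \<open>m\<close> and \<open>s\<close>, so it yields the same
  moments for all unit vectors.\<close>

lemma nn_integral_powr:
  assumes s: "s \<noteq> 0" "\<bar>s\<bar> < 1 / 2"
  shows "(\<integral>\<^sup>+\<omega>. ennreal (W \<omega> powr s) \<partial>M) =
    mellin (power_kernel s (product_transform y m)) s / mellin (power_kernel s (\<lambda>x. exp (- x))) s" (is "?I = _ / ?K")
    and "(\<integral>\<^sup>+\<omega>. ennreal (W \<omega> powr s) \<partial>M) < \<infinity>"
proof -
  interpret pair_sigma_finite M lborel ..
  let ?\<phi> = "power_kernel s (\<lambda>x. exp (- x))"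
  have \<phi>: "?\<phi> x \<ge> 0" if "x \<ge> 0" for x
    using that by (simp add: power_kernel_def)
  have K: "?K < \<infinity>" "?K \<noteq> 0"
    using mellin_power_kernel_exp[OF s] by auto
  have inner: "(\<integral>\<^sup>+\<omega>. ennreal (?\<phi> (x * W \<omega>) * x powr (- s - 1)) * indicator {0<..} x \<partial>M) =
      ennreal (power_kernel s (product_transform y m) x * x powr (- s - 1)) * indicator {0<..} x" for x
  proof (cases "x > 0")
    case True
    have int: "integrable M (\<lambda>\<omega>. ?\<phi> (x * W \<omega>))"
      using integrable_exp[OF True] by (cases "s < 0") (simp_all add: power_kernel_def)
    have "expectation (\<lambda>\<omega>. ?\<phi> (x * W \<omega>)) = power_kernel s (product_transform y m) x"
      using integrable_exp[OF True] laplace[OF True]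
      by (cases "s < 0") (simp_all add: power_kernel_def prob_space)
    then have "(\<integral>\<^sup>+\<omega>. ennreal (?\<phi> (x * W \<omega>)) \<partial>M) = ennreal (power_kernel s (product_transform y m) x)"
      using True W_nonneg by (subst nn_integral_eq_integral[OF int]) (auto intro!: \<phi>)
    then show ?thesis
      using True by (simp add: ennreal_mult'' nn_integral_multc)
  qed simp
  have "mellin (power_kernel s (product_transform y m)) s =
      (\<integral>\<^sup>+x. \<integral>\<^sup>+\<omega>. ennreal (?\<phi> (x * W \<omega>) * x powr (- s - 1)) * indicator {0<..} x \<partial>M \<partial>lborel)"
    by (simp only: inner mellin_def)
  also have "\<dots> = (\<integral>\<^sup>+\<omega>. \<integral>\<^sup>+x. ennreal (?\<phi> (x * W \<omega>) * x powr (- s - 1)) * indicator {0<..} x \<partial>lborel \<partial>M)"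
    by (rule Fubini') (simp add: power_kernel_def)
  also have "\<dots> = (\<integral>\<^sup>+\<omega>. ennreal (W \<omega> powr s) * ?K \<partial>M)"
    unfolding mellin_def using AE_pos
    by (intro nn_integral_cong_AE) (auto simp: nn_integral_scale_powr \<phi>)
  also have "\<dots> = ?I * ?K"
    by (simp add: nn_integral_multc)
  finally have eq: "?I * ?K = mellin (power_kernel s (product_transform y m)) s" ..
  then show "?I = mellin (power_kernel s (product_transform y m)) s / ?K"
    using K by (metis ennreal_mult_divide_eq infinity_ennreal_def order_less_irrefl)
  have "mellin (power_kernel s (product_transform y m)) s < \<infinity>"
  proof (rule mellin_power_kernel_finite[OF s, of _ "max (\<Sum>i\<in>UNIV. m / y i) (y undefined powr (1 / 2))"])
    fix x :: real assume x: "x > 0"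
    show "1 - product_transform y m x \<le> max (\<Sum>i\<in>UNIV. m / y i) (y undefined powr (1 / 2)) * x"
      using x by (intro order_trans[OF transform_bounds(3)[OF x]] mult_right_mono) auto
    show "product_transform y m x \<le> max (\<Sum>i\<in>UNIV. m / y i) (y undefined powr (1 / 2)) * x powr (- (1 / 2))"
    proof -
      have "product_transform y m x \<le> y undefined powr (1 / 2) * x powr (- (1 / 2))"
        using x by (rule transform_bounds(4))
      also have "\<dots> \<le> max (\<Sum>i\<in>UNIV. m / y i) (y undefined powr (1 / 2)) * x powr (- (1 / 2))"
        by (intro mult_right_mono) auto
      finally show ?thesis .
    qed
  qed (auto intro: transform_bounds(1,2))
  then show "?I < \<infinity>"
    using eq K by (metis ennreal_top_mult infinity_ennreal_def order_less_irrefl top.not_eq_extremum)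
qed

lemma integrable_powr: "\<bar>s\<bar> < 1 / 2 \<Longrightarrow> integrable M (\<lambda>\<omega>. W \<omega> powr s)"
proof (cases "s = 0")
  case True
  then show ?thesis by (intro integrable_const_bound[where B = 1]) auto
next
  case False
  assume "\<bar>s\<bar> < 1 / 2"
  with False show ?thesis
    using nn_integral_powr(2)[of s] by (intro integrableI_nonneg) auto
qed

text \<open>Applying \<open>ln a \<le> a\<close> to the powers of \<open>W\<close> with exponents
  1/4 and -1/4, both inside the window of finite moments.\<close>

lemma integrable_ln: "integrable M (\<lambda>\<omega>. ln (W \<omega>))"
proof (rule Bochner_Integration.integrable_bound)
  show "integrable M (\<lambda>\<omega>. 4 * (W \<omega> powr (1 / 4) + W \<omega> powr (- (1 / 4))))"
    by (intro integrable_mult_right Bochner_Integration.integrable_add integrable_powr) auto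
  show "AE \<omega> in M. norm (ln (W \<omega>)) \<le> norm (4 * (W \<omega> powr (1 / 4) + W \<omega> powr (- (1 / 4))))"
    using AE_pos
  proof eventually_elim
    case (elim \<omega>)
    define a b where "a = W \<omega> powr (1 / 4)" and "b = W \<omega> powr (- (1 / 4))"
    have ab: "a > 0" "b > 0" "ln a = ln (W \<omega>) / 4" "ln b = - ln (W \<omega>) / 4"
      using elim by (simp_all add: a_def b_def ln_powr)
    have "ln (W \<omega>) \<le> 4 * a" "- ln (W \<omega>) \<le> 4 * b"
      using ln_bound[OF ab(1)] ln_bound[OF ab(2)] unfolding ab(3,4) by (simp_all add: field_simps)
    then have "\<bar>ln (W \<omega>)\<bar> \<le> 4 * (a + b)"
      unfolding distrib_left abs_le_iff using ab(1,2) by (intro conjI) simp_all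
    then have "\<bar>ln (W \<omega>)\<bar> \<le> 4 * (W \<omega> powr (1 / 4) + W \<omega> powr (- (1 / 4)))"
      by (simp only: a_def b_def)
    then show ?case
      by (simp only: real_norm_def order_trans[OF _ abs_ge_self])
  qed
qed measurable

text \<open>Fubini for the Frullani kernel at \<open>W\<close>: its absolute integral in
  \<open>x\<close> grows only like a constant plus \<open>|ln W|\<close>, which is
  integrable.\<close>

lemma expectation_ln:
  "expectation (\<lambda>\<omega>. ln (W \<omega>)) =
    - euler_mascheroni + (LBINT x:{0<..}. (indicator {0..1} x - product_transform y m x) / x)"
proof -
  interpret pair_sigma_finite M lborel ..
  let ?F = "\<lambda>\<omega> x. frullani_kernel (W \<omega>) x"
  have meas: "case_prod ?F \<in> borel_measurable (M \<Otimes>\<^sub>M lborel)"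
    unfolding frullani_kernel_def by measurable
  have "integrable (M \<Otimes>\<^sub>M lborel) (case_prod ?F)"
  proof (rule Fubini_integrable[OF meas])
    have "integrable M (\<lambda>\<omega>. LINT x|lborel. norm (?F \<omega> x))"
    proof (rule Bochner_Integration.integrable_bound)
      show "integrable M (\<lambda>\<omega>. (LINT x|lborel. \<bar>frullani_kernel 1 x\<bar>) + \<bar>ln (W \<omega>)\<bar>)"
        using integrable_ln by simp
      show "(\<lambda>\<omega>. LINT x|lborel. norm (?F \<omega> x)) \<in> borel_measurable M"
        using meas by measurable
      show "AE \<omega> in M. norm (LINT x|lborel. norm (?F \<omega> x)) \<le> norm ((LINT x|lborel. \<bar>frullani_kernel 1 x\<bar>) + \<bar>ln (W \<omega>)\<bar>)"
        using AE_pos by eventually_elim (use frullani_kernel_integral(2) in \<open>simp add: abs_of_nonneg\<close>)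
    qed
    then show "integrable M (\<lambda>\<omega>. LINT x|lborel. norm (case_prod ?F (\<omega>, x)))"
      by simp
    show "AE \<omega> in M. integrable lborel (\<lambda>x. case_prod ?F (\<omega>, x))"
      using AE_pos by eventually_elim (use frullani_kernel_integral(1) in \<open>auto simp: has_bochner_integral_iff\<close>)
  qed
  from Fubini_integral[OF this]
  have "(LINT \<omega>|M. LINT x|lborel. ?F \<omega> x) = (LINT x|lborel. expectation (\<lambda>\<omega>. ?F \<omega> x))" ..
  also have "(LINT \<omega>|M. LINT x|lborel. ?F \<omega> x) = expectation (\<lambda>\<omega>. euler_mascheroni + ln (W \<omega>))"
    using meas AE_pos frullani_kernel_integral(1)
    by (intro integral_cong_AE) (auto simp: has_bochner_integral_iff)
  also have "\<dots> = euler_mascheroni + expectation (\<lambda>\<omega>. ln (W \<omega>))"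
    using integrable_ln by (simp add: prob_space)
  also have "(LINT x|lborel. expectation (\<lambda>\<omega>. ?F \<omega> x)) =
      (LBINT x:{0<..}. (indicator {0..1} x - product_transform y m x) / x)"
    unfolding set_lebesgue_integral_def
  proof (rule Bochner_Integration.integral_cong[OF refl])
    fix x :: real
    show "expectation (\<lambda>\<omega>. ?F \<omega> x) = indicator {0<..} x *\<^sub>R ((indicator {0..1} x - product_transform y m x) / x)"
      using integrable_exp[of x] laplace[of x]
      by (cases "x > 0") (simp_all add: frullani_kernel_def prob_space)
  qed
  finally show ?thesis by simp
qed

text \<open>Dominated convergence. Of the available exponent 1/4, one half absorbs
  \<open>exp |s n * l|\<close>, as \<open>|s n| \<le> 1 / 8\<close>, and the other half absorbs the
  factor \<open>|l|\<close>.\<close>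

lemma moment_difference_quotient:
  fixes s :: "nat \<Rightarrow> real"
  assumes s: "s \<longlonglongrightarrow> 0" "\<And>n. s n \<noteq> 0" "\<And>n. \<bar>s n\<bar> \<le> 1 / 8"
  shows "(\<lambda>n. (expectation (\<lambda>\<omega>. W \<omega> powr s n) - 1) / s n) \<longlonglongrightarrow> expectation (\<lambda>\<omega>. ln (W \<omega>))"
proof -
  have "(\<lambda>n. expectation (\<lambda>\<omega>. (W \<omega> powr s n - 1) / s n)) \<longlonglongrightarrow> expectation (\<lambda>\<omega>. ln (W \<omega>))"
  proof (rule integral_dominated_convergence)
    show "integrable M (\<lambda>\<omega>. 8 * (W \<omega> powr (1 / 4) + W \<omega> powr (- (1 / 4))))"
      by (intro integrable_mult_right Bochner_Integration.integrable_add integrable_powr) auto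
    show "AE \<omega> in M. (\<lambda>n. (W \<omega> powr s n - 1) / s n) \<longlonglongrightarrow> ln (W \<omega>)"
      using AE_pos
    proof eventually_elim
      case (elim \<omega>)
      have "((\<lambda>t. W \<omega> powr t) has_field_derivative ln (W \<omega>)) (at 0)"
        using elim by (auto intro!: derivative_eq_intros simp: powr_def)
      then have "((\<lambda>t. (W \<omega> powr t - 1) / t) \<longlongrightarrow> ln (W \<omega>)) (at 0)"
        using elim by (simp add: has_field_derivative_iff)
      moreover have "filterlim s (at 0) sequentially"
        using s by (auto simp: filterlim_at)
      ultimately show ?case
        by (rule filterlim_compose)
    qed
    show "AE \<omega> in M. norm ((W \<omega> powr s n - 1) / s n) \<le> 8 * (W \<omega> powr (1 / 4) + W \<omega> powr (- (1 / 4)))" for n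
      using AE_pos
    proof eventually_elim
      case (elim \<omega>)
      define l where "l = ln (W \<omega>)"
      \<comment> \<open>A mean value estimate, obtained for either sign from
        \<open>1 + t \<le> exp t\<close>.\<close>
      have "\<bar>exp (s n * l) - 1\<bar> \<le> \<bar>s n * l\<bar> * exp \<bar>s n * l\<bar>"
      proof (cases "s n * l \<ge> 0")
        case True
        have "1 - s n * l \<le> exp (- (s n * l))"
          using exp_ge_add_one_self[of "- (s n * l)"] by simp
        then have "exp (s n * l) * (1 - s n * l) \<le> exp (s n * l) * exp (- (s n * l))"
          by (intro mult_left_mono) auto
        then show ?thesis
          using True by (simp add: algebra_simps flip: exp_add)
      next
        case False
        have "1 - exp (s n * l) \<le> \<bar>s n * l\<bar> * 1"
          using exp_ge_add_one_self[of "s n * l"] False by (simp only: mult_1_right)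
        also have "\<dots> \<le> \<bar>s n * l\<bar> * exp \<bar>s n * l\<bar>"
          by (intro mult_left_mono) auto
        finally show ?thesis
          using False by simp
      qed
      also have "\<bar>s n * l\<bar> * exp \<bar>s n * l\<bar> \<le> \<bar>s n\<bar> * (8 * exp (\<bar>l\<bar> / 8)) * exp (\<bar>l\<bar> / 8)"
      proof (intro mult_mono)
        have "\<bar>l\<bar> \<le> 8 * exp (\<bar>l\<bar> / 8)"
          using exp_ge_add_one_self[of "\<bar>l\<bar> / 8"] by linarith
        then show "\<bar>s n * l\<bar> \<le> \<bar>s n\<bar> * (8 * exp (\<bar>l\<bar> / 8))"
          by (simp add: abs_mult mult_left_mono)
        show "exp \<bar>s n * l\<bar> \<le> exp (\<bar>l\<bar> / 8)"
          using mult_right_mono[OF s(3)[of n], of "\<bar>l\<bar>"] by (simp add: abs_mult)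
      qed auto
      also have "\<dots> = \<bar>s n\<bar> * (8 * exp (\<bar>l\<bar> / 4))"
        by (simp flip: exp_add)
      also have "exp (\<bar>l\<bar> / 4) \<le> exp (l / 4) + exp (- (l / 4))"
        by (cases "l \<ge> 0") (auto simp: add_increasing add_increasing2)
      finally have "\<bar>exp (s n * l) - 1\<bar> \<le> \<bar>s n\<bar> * (8 * (exp (l / 4) + exp (- (l / 4))))"
        by (simp add: mult_left_mono)
      then have "\<bar>exp (s n * l) - 1\<bar> / \<bar>s n\<bar> \<le> 8 * (exp (l / 4) + exp (- (l / 4)))"
        using s(2)[of n] by (simp add: divide_le_eq mult_ac)
      then show ?case
        using elim by (simp add: powr_def l_def)
    qed
  qed measurable
  moreover have "expectation (\<lambda>\<omega>. (W \<omega> powr s n - 1) / s n) = (expectation (\<lambda>\<omega>. W \<omega> powr s n) - 1) / s n" for n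
    using integrable_powr[of "s n"] s(3)[of n] by (simp add: prob_space)
  ultimately show ?thesis by (simp only:)
qed

lemma moment_derivative:
  "((\<lambda>s. expectation (\<lambda>\<omega>. W \<omega> powr s)) has_real_derivative expectation (\<lambda>\<omega>. ln (W \<omega>))) (at 0)"
proof -
  \<comment> \<open>Almost surely only, since \<open>0 powr 0 = 0\<close>.\<close>
  have "AE \<omega> in M. W \<omega> powr 0 = 1"
    using AE_pos by eventually_elim simp
  then have 0: "expectation (\<lambda>\<omega>. W \<omega> powr 0) = 1"
    by (subst integral_cong_AE[of _ _ "\<lambda>_. 1"]) (auto simp: prob_space)
  \<comment> \<open>Restricting to a neighbourhood of 0 supplies the bound 1/8 for every sequence
    and leaves the limit at 0 unchanged.\<close>
  have "((\<lambda>s. (expectation (\<lambda>\<omega>. W \<omega> powr s) - 1) / s) \<longlongrightarrow> expectation (\<lambda>\<omega>. ln (W \<omega>))) (at 0 within {- 1 / 8..1 / 8})"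
    unfolding tendsto_at_iff_sequentially o_def
  proof (intro allI impI moment_difference_quotient)
    fix X :: "nat \<Rightarrow> real" and i
    assume X: "\<forall>i. X i \<in> {- 1 / 8..1 / 8} - {0}"
    from spec[OF X, of i] have "X i \<noteq> 0" "X i \<le> 1 / 8" "- X i \<le> 1 / 8"
      by simp_all
    then show "X i \<noteq> 0" "\<bar>X i\<bar> \<le> 1 / 8"
      by - (assumption, rule abs_leI)
  qed
  moreover have "at 0 within {- 1 / 8..1 / 8} = at (0::real)"
    by (rule at_within_interior) simp
  ultimately show ?thesis
    by (simp only: has_field_derivative_iff 0 diff_zero)
qed

end

section \<open>Gaussian matrices\<close>

lemma borel_measurable_vec_lambda [measurable (raw)]:
  fixes f :: "'i::finite \<Rightarrow> 'x \<Rightarrow> 'b::euclidean_space"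
  assumes [measurable]: "\<And>i. f i \<in> borel_measurable M"
  shows "(\<lambda>x. \<chi> i. f i x) \<in> borel_measurable M"
  unfolding borel_measurable_euclidean_space[of "\<lambda>x. \<chi> i. f i x"]
  by (auto simp: Basis_vec_def inner_axis)

lemma borel_measurable_vec_nth [measurable (raw)]:
  fixes f :: "'x \<Rightarrow> 'b::euclidean_space ^ 'i"
  assumes "f \<in> borel_measurable M"
  shows "(\<lambda>x. f x $ i) \<in> borel_measurable M"
  using borel_measurable_continuous_onI[OF continuous_on_component[OF continuous_on_id]] assms
  by (rule measurable_compose[rotated])

lemma borel_measurable_matrix_mult [measurable (raw)]:
  fixes f g :: "'x \<Rightarrow> 'a::star_scalar ^ 'n ^ 'n"
  assumes [measurable]: "f \<in> borel_measurable M" "g \<in> borel_measurable M"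
  shows "(\<lambda>x. f x ** g x) \<in> borel_measurable M"
  unfolding matrix_matrix_mult_def by measurable

lemma borel_measurable_matrix_vector_mult [measurable (raw)]:
  fixes f :: "'x \<Rightarrow> 'a::star_scalar ^ 'n ^ 'n"
  assumes [measurable]: "f \<in> borel_measurable M"
  shows "(\<lambda>x. f x *v u) \<in> borel_measurable M"
  unfolding matrix_vector_mult_def by measurable

lemma standard_gaussian_measurable:
  "(\<lambda>w. \<chi> i j. \<Sum>b\<in>Basis. w (i, j, b) *\<^sub>R b) \<in>
    (\<Pi>\<^sub>M k \<in> UNIV \<times> UNIV \<times> (Basis :: 'a::star_scalar set). normal_law \<sigma>) \<rightarrow>\<^sub>M (borel :: ('a ^ 'n ^ 'n) measure)"
proof -
  have [measurable]: "(\<lambda>w. w k) \<in> borel_measurable (\<Pi>\<^sub>M k \<in> UNIV \<times> UNIV \<times> (Basis :: 'a set). normal_law \<sigma>)"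
    if "k \<in> UNIV \<times> UNIV \<times> Basis" for k :: "'n \<times> 'n \<times> 'a"
    using measurable_component_singleton[OF that, of "\<lambda>_. normal_law \<sigma>"] by simp
  show ?thesis by measurable
qed

lemma sets_standard_gaussian_law [simp, measurable_cong]: "sets standard_gaussian_law = sets borel"
  by (simp add: standard_gaussian_law_def)

lemma sets_gaussian_law [simp, measurable_cong]: "sets (gaussian_law S) = sets borel"
  by (simp add: gaussian_law_def)

lemma prob_space_standard_gaussian_law:
  "prob_space (standard_gaussian_law :: ('a::star_scalar ^ 'n ^ 'n) measure)"
  unfolding standard_gaussian_law_def
  by (intro prob_space.prob_space_distr prob_space_PiM prob_space_normal_density standard_gaussian_measurable) simp

lemma prob_space_gaussian_law: "prob_space (gaussian_law S)"
  unfolding gaussian_law_def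
  by (intro prob_space.prob_space_distr prob_space_standard_gaussian_law) measurable

text \<open>
  For a unit vector \<open>u\<close> the adjoint of \<open>G \<mapsto> G u\<close> is isometric, so \<open>G u\<close> has orthonormal
  coordinates as linear forms in the entries of \<open>G\<close>.
\<close>

lemma standard_gaussian_laplace:
  fixes u :: "'a::star_scalar ^ 'n"
  assumes u: "norm u = 1" and C: "finite C" "pairwise orthogonal C" "\<And>c. c \<in> C \<Longrightarrow> norm c = 1"
    and \<theta>: "\<And>c. c \<in> C \<Longrightarrow> \<theta> c \<ge> 0"
  shows "(LINT G|standard_gaussian_law. exp (- (\<Sum>c\<in>C. \<theta> c * (inner (G *v u) c)\<^sup>2))) =
    (\<Prod>c\<in>C. (1 + 2 / DIM('a) * \<theta> c) powr (- (1 / 2)))"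
proof -
  let ?K = "(UNIV :: 'n set) \<times> (UNIV :: 'n set) \<times> (Basis :: 'a set)"
  let ?\<sigma> = "1 / sqrt (real DIM('a))"
  \<comment> \<open>The coefficient of the real component \<open>w (i, j, b)\<close> in
    \<open>inner (G *v u) c\<close>.\<close>
  define a where "a c = (\<lambda>(i, j, b). inner (c $ i) (b * u $ j))" for c :: "'a ^ 'n"
  have inner_eq: "inner ((\<chi> i j. \<Sum>b\<in>Basis. w (i, j, b) *\<^sub>R b) *v u) c = (\<Sum>k\<in>?K. a c k * w k)"
    for c :: "'a ^ 'n" and w
  proof -
    have "inner ((\<chi> i j. \<Sum>b\<in>Basis. w (i, j, b) *\<^sub>R b) *v u) c =
        (\<Sum>i\<in>UNIV. \<Sum>j\<in>UNIV. \<Sum>b\<in>Basis. a c (i, j, b) * w (i, j, b))"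
      by (simp add: inner_vec_def matrix_vector_mult_def inner_sum_left inner_sum_right sum_distrib_right a_def
          inner_commute mult.commute)
    then show ?thesis
      by (simp add: sum.cartesian_product case_prod_beta)
  qed
  have orth: "(\<Sum>k\<in>?K. a c k * a c' k) = (if c = c' then 1 else 0)" if "c \<in> C" "c' \<in> C" for c c'
  proof -
    \<comment> \<open>Moving \<open>u $ j\<close> across by conjugation turns the sum over
      \<open>b\<close> into Parseval's identity in the scalars; the factors
      \<open>(norm (u $ j))\<^sup>2\<close> then sum to 1.\<close>
    have "(\<Sum>b\<in>Basis. a c (i, j, b) * a c' (i, j, b)) = (norm (u $ j))\<^sup>2 * inner (c $ i) (c' $ i)" for i j
    proof -
      have "inner x (b * u $ j) = inner (x * conjg (u $ j)) b" for x b
        using inner_mult_right_conjg[of b "u $ j" x] by (simp add: inner_commute)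
      then have "(\<Sum>b\<in>Basis. a c (i, j, b) * a c' (i, j, b)) =
          inner (c $ i * conjg (u $ j)) (c' $ i * conjg (u $ j))"
        by (simp add: a_def flip: euclidean_inner)
      then show ?thesis
        by (simp add: inner_mult_mult_right)
    qed
    then have "(\<Sum>i\<in>UNIV. \<Sum>j\<in>UNIV. \<Sum>b\<in>Basis. a c (i, j, b) * a c' (i, j, b)) =
        (\<Sum>i\<in>UNIV. \<Sum>j\<in>UNIV. (norm (u $ j))\<^sup>2 * inner (c $ i) (c' $ i))"
      by simp
    also have "\<dots> = (norm u)\<^sup>2 * inner c c'"
      by (simp add: norm_vec_def L2_set_def sum_nonneg inner_vec_def flip: sum_distrib_left sum_distrib_right)
    also have "inner c c' = (if c = c' then 1 else 0)"
      using C(2,3) that by (auto simp: pairwise_def orthogonal_def norm_eq_1)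
    finally show ?thesis
      by (simp add: u sum.cartesian_product case_prod_beta)
  qed
  have "(LINT G|standard_gaussian_law. exp (- (\<Sum>c\<in>C. \<theta> c * (inner (G *v u) c)\<^sup>2))) =
      (LINT w|(\<Pi>\<^sub>M k\<in>?K. normal_law ?\<sigma>). exp (- (\<Sum>c\<in>C. \<theta> c * (\<Sum>k\<in>?K. a c k * w k)\<^sup>2)))"
    unfolding standard_gaussian_law_def inner_eq[symmetric]
    by (rule integral_distr[OF standard_gaussian_measurable]) measurable
  also have "\<dots> = (\<Prod>c\<in>C. (1 + 2 * ?\<sigma>\<^sup>2 * \<theta> c) powr (- (1 / 2)))"
    using C(1) \<theta> orth by (intro laplace_transform_gaussian_quadratic_form) auto
  finally show ?thesis
    by (simp add: power_divide)
qed

text \<open>In the eigenbasis \<open>|A u|\<^sup>2\<close> is the sum of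
  \<open>e c * (inner (G *v u) c)\<^sup>2\<close>. The factor \<beta>/2 cancels twice the entry
  variance 1/\<beta>, leaving \<open>1 + x * e c\<close>.\<close>

lemma gaussian_law_laplace:
  fixes S :: "'a::star_scalar ^ 'n ^ 'n"
  assumes pd: "positive_definite S" and ev: "eigenvalues_with_mult S (\<lambda>i. 1 / y i)"
    and y: "\<And>i. y i > 0" and u: "norm u = 1"
  shows "product_laplace_law (gaussian_law S) (\<lambda>A. DIM('a) / 2 * (norm (A *v u))\<^sup>2) y (DIM('a) / 2)"
proof -
  interpret prob_space "gaussian_law S" by (rule prob_space_gaussian_law)
  have sa: "self_adjoint S"
    using pd by (simp add: positive_definite_def)
  obtain C e where C: "finite C" "pairwise orthogonal C" "\<And>c. c \<in> C \<Longrightarrow> norm c = 1"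
    "span C = UNIV" and e: "\<And>c. c \<in> C \<Longrightarrow> S *v c = e c *\<^sub>R c"
    and prod: "\<And>f::real \<Rightarrow> real. (\<Prod>c\<in>C. f (e c)) = (\<Prod>i\<in>UNIV. f (1 / y i) ^ DIM('a))"
    using eigenvalues_with_mult_eigenbasis[OF sa ev] by metis
  have e_pos: "e c > 0" if "c \<in> C" for c
    using positive_definite_eigenvalue_pos[OF pd e[OF that]] C(3)[OF that] by force
  have R: "(norm (pd_sqrt S *v v))\<^sup>2 = (\<Sum>c\<in>C. e c * (inner v c)\<^sup>2)" for v
    using norm_pd_sqrt[OF pd ev] inner_eigenbasis[OF C matrix_vector_linear e] by simp
  show ?thesis
  proof
    fix x :: real assume x: "x > 0"
    have "expectation (\<lambda>A. exp (- (x * (DIM('a) / 2 * (norm (A *v u))\<^sup>2)))) =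
        (LINT G|standard_gaussian_law. exp (- (x * (DIM('a) / 2 * (norm ((pd_sqrt S ** G) *v u))\<^sup>2))))"
      unfolding gaussian_law_def by (rule integral_distr) measurable
    also have "\<dots> = (LINT G|standard_gaussian_law. exp (- (\<Sum>c\<in>C. (x * DIM('a) / 2 * e c) * (inner (G *v u) c)\<^sup>2)))"
      by (simp add: R sum_distrib_left mult_ac flip: matrix_vector_mul_assoc)
    also have "\<dots> = (\<Prod>c\<in>C. (1 + 2 / DIM('a) * (x * DIM('a) / 2 * e c)) powr (- (1 / 2)))"
      using x e_pos by (intro standard_gaussian_laplace u C) (auto simp: less_imp_le)
    also have "\<dots> = (\<Prod>c\<in>C. (1 + x * e c) powr (- (1 / 2)))"
      by simp
    also have "\<dots> = (\<Prod>i\<in>UNIV. ((1 + x * (1 / y i)) powr (- (1 / 2))) ^ DIM('a))"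
      by (rule prod)
    also have "\<dots> = product_transform y (DIM('a) / 2) x"
      unfolding product_transform_def
    proof (intro prod.cong refl)
      fix i
      have "1 + x * (1 / y i) > 0"
        using x y[of i] by (simp add: add_pos_pos)
      then show "((1 + x * (1 / y i)) powr (- (1 / 2))) ^ DIM('a) = (1 + x / y i) powr (- (DIM('a) / 2))"
        by (simp add: powr_powr flip: powr_realpow)
    qed
    finally show "expectation (\<lambda>A. exp (- (x * (DIM('a) / 2 * (norm (A *v u))\<^sup>2)))) =
      product_transform y (DIM('a) / 2) x" .
  next
    have "1 \<le> DIM('a)" using DIM_positive[where 'a = 'a] by linarith
    then show "1 / 2 \<le> real DIM('a) / 2" by simp
  qed (use y in auto)
qed

section \<open>Products of random matrices\<close>

lemma matrix_product_cong:
  "(\<And>k. 1 \<le> k \<Longrightarrow> k \<le> n \<Longrightarrow> A k = B k) \<Longrightarrow> matrix_product A n = matrix_product B n"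
  by (induction n) simp_all

lemma matrix_product_measurable [measurable (raw)]:
  fixes A :: "nat \<Rightarrow> 'x \<Rightarrow> 'a::star_scalar ^ 'n ^ 'n"
  assumes "\<And>k. 1 \<le> k \<Longrightarrow> k \<le> n \<Longrightarrow> A k \<in> borel_measurable M"
  shows "(\<lambda>x. matrix_product (\<lambda>k. A k x) n) \<in> borel_measurable M"
  using assms
proof (induction n)
  case (Suc n)
  have [measurable]: "A (Suc n) \<in> borel_measurable M" "(\<lambda>x. matrix_product (\<lambda>k. A k x) n) \<in> borel_measurable M"
    using Suc by simp_all
  show ?case by simp
qed simp

lemma norm_axis: "norm (axis j q) = norm q" for q :: "'a::real_inner"
  by (simp add: norm_eq_sqrt_inner inner_axis)

lemma onorm_matrix_bounds:
  fixes P :: "'a::star_scalar ^ 'n ^ 'n"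
  shows "norm (P *v axis j 1) \<le> onorm (\<lambda>v. P *v v)"
    and "onorm (\<lambda>v. P *v v) \<le> (\<Sum>j\<in>UNIV. norm (P *v axis j 1))"
proof -
  have "norm (axis j (1::'a)) = 1"
    by (simp add: norm_axis)
  with onorm[OF matrix_vector_mul_bounded_linear, of P "axis j 1"]
  show "norm (P *v axis j 1) \<le> onorm (\<lambda>v. P *v v)"
    by simp
  show "onorm (\<lambda>v. P *v v) \<le> (\<Sum>j\<in>UNIV. norm (P *v axis j 1))"
  proof (rule onorm_bound)
    fix v :: "'a ^ 'n"
    \<comment> \<open>The coordinate \<open>v $ j\<close> leaves \<open>P *v axis j (v $ j)\<close>
      on the right, where the norm is multiplicative.\<close>
    have norm_right: "norm (\<chi> i. x $ i * q) = norm x * norm q" for x :: "'a ^ 'n" and q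
      by (simp add: norm_vec_def norm_mult L2_set_right_distrib flip: L2_set_left_distrib)
    have "v = (\<Sum>j\<in>UNIV. axis j (v $ j))"
      by (simp add: vec_eq_iff axis_def)
    then have "P *v v = (\<Sum>j\<in>UNIV. P *v axis j (v $ j))"
      by (metis linear_sum matrix_vector_linear)
    also have "axis j (v $ j) = (\<chi> i. axis j 1 $ i * v $ j)" for j
      by (simp add: vec_eq_iff axis_def)
    then have "(\<Sum>j\<in>UNIV. P *v axis j (v $ j)) = (\<Sum>j\<in>UNIV. \<chi> i. (P *v axis j 1) $ i * v $ j)"
      by (simp only: matrix_vector_mult_right)
    also have "norm \<dots> \<le> (\<Sum>j\<in>UNIV. norm (P *v axis j 1) * norm (v $ j))"
      by (rule order_trans[OF norm_sum]) (simp add: norm_right)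
    also have "\<dots> \<le> (\<Sum>j\<in>UNIV. norm (P *v axis j 1) * norm v)"
      by (intro sum_mono mult_left_mono Finite_Cartesian_Product.norm_nth_le norm_ge_zero)
    finally show "norm (P *v v) \<le> (\<Sum>j\<in>UNIV. norm (P *v axis j 1)) * norm v"
      by (simp add: sum_distrib_right)
  qed (simp add: sum_nonneg)
qed

text \<open>
  The law of the norm of \<open>A k u\<close> enters only through its moments, which must not depend on the
  unit vector \<open>u\<close>.
\<close>

locale isotropic_matrix_products = prob_space M for M :: "'w measure" +
  fixes A :: "nat \<Rightarrow> 'w \<Rightarrow> 'a::star_scalar ^ 'n ^ 'n" and Q :: "('a ^ 'n ^ 'n) measure"
    and d :: "real \<Rightarrow> real" and \<mu> :: real
  assumes indep: "indep_vars (\<lambda>_. borel) A {1..}"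
    and law: "\<And>k. k \<ge> 1 \<Longrightarrow> distr M borel (A k) = Q"
    and moments: "\<And>u s. norm u = 1 \<Longrightarrow> \<bar>s\<bar> < 1 \<Longrightarrow> (\<integral>\<^sup>+B. ennreal (norm (B *v u) powr s) \<partial>Q) = ennreal (d s)"
    and moment_nonneg: "\<And>s. d s \<ge> 0"
    and moment_0: "d 0 = 1"
    and moment_deriv: "(d has_real_derivative \<mu>) (at 0)"
begin

lemma A_measurable [measurable]: "k \<ge> 1 \<Longrightarrow> A k \<in> borel_measurable M"
  using indep by (auto simp: indep_vars_def)

lemma A_measurable_Suc [measurable]: "A (Suc k) \<in> borel_measurable M"
  by simp

lemma sets_Q [simp, measurable_cong]: "sets Q = sets borel"
  using law[of 1] by auto

lemma prob_space_Q: "prob_space Q"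
  using law[of 1] prob_space_distr[of "A 1" borel] by simp

text \<open>Homogeneity passes to arbitrary vectors, since the next factor acts on a random vector
  of any length. At \<open>v = 0\<close> both sides vanish because
  \<open>0 powr s = 0\<close>.\<close>

lemma moments_scaled:
  assumes "\<bar>s\<bar> < 1"
  shows "(\<integral>\<^sup>+B. ennreal (norm (B *v v) powr s) \<partial>Q) = ennreal (norm v powr s) * ennreal (d s)"
proof (cases "v = 0")
  case False
  have "B *v v = norm v *\<^sub>R (B *v (v /\<^sub>R norm v))" for B :: "'a ^ 'n ^ 'n"
    using False by (simp add: linear_cmul[OF matrix_vector_linear])
  then have "norm (B *v v) powr s = norm v powr s * norm (B *v (v /\<^sub>R norm v)) powr s" for B :: "'a ^ 'n ^ 'n"
    by (metis abs_norm_cancel norm_scaleR powr_mult)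
  then have "(\<integral>\<^sup>+B. ennreal (norm (B *v v) powr s) \<partial>Q) =
      (\<integral>\<^sup>+B. ennreal (norm v powr s) * ennreal (norm (B *v (v /\<^sub>R norm v)) powr s) \<partial>Q)"
    by (simp only: ennreal_mult powr_ge_zero)
  also have "\<dots> = ennreal (norm v powr s) * (\<integral>\<^sup>+B. ennreal (norm (B *v (v /\<^sub>R norm v)) powr s) \<partial>Q)"
    by (rule nn_integral_cmult) measurable
  also have "(\<integral>\<^sup>+B. ennreal (norm (B *v (v /\<^sub>R norm v)) powr s) \<partial>Q) = ennreal (d s)"
    using False assms by (intro moments) simp_all
  finally show ?thesis .
qed simp

text \<open>By independence the computation moves to the product measure of copies of
  \<open>Q\<close>, where conditioning on the earlier factors is integration over the last
  coordinate with the others fixed.\<close>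

lemma moments_product:
  assumes u: "norm u = 1" and s: "\<bar>s\<bar> < 1"
  shows "(\<integral>\<^sup>+\<omega>. ennreal (norm (matrix_product (\<lambda>k. A k \<omega>) n *v u) powr s) \<partial>M) = ennreal (d s) ^ n"
proof -
  interpret Q: prob_space Q by (rule prob_space_Q)
  interpret P: product_sigma_finite "\<lambda>_::nat. Q"
    by (intro product_sigma_finite.intro prob_space_imp_sigma_finite prob_space_Q)
  let ?f = "\<lambda>n w. ennreal (norm (matrix_product w n *v u) powr s)"
  have meas: "?f n \<in> borel_measurable (\<Pi>\<^sub>M k\<in>I. Q)" if "{1..n} \<subseteq> I" for n and I :: "nat set"
  proof -
    have [measurable]: "(\<lambda>w. matrix_product (\<lambda>k. w k) n) \<in> borel_measurable (\<Pi>\<^sub>M k\<in>I. Q)"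
    proof (rule matrix_product_measurable)
      fix k assume "1 \<le> k" "k \<le> n"
      then have "k \<in> I" using that by auto
      from measurable_component_singleton[OF this, of "\<lambda>_. Q"]
      show "(\<lambda>w. w k) \<in> borel_measurable (\<Pi>\<^sub>M k\<in>I. Q)"
        by (simp cong: measurable_cong_sets)
    qed
    show ?thesis by measurable
  qed
  have PiM: "(\<integral>\<^sup>+w. ?f n w \<partial>(\<Pi>\<^sub>M k\<in>{1..n}. Q)) = ennreal (d s) ^ n" for n
  proof (induction n)
    case 0
    then show ?case by (simp add: u PiM_empty nn_integral_count_space_finite)
  next
    case (Suc n)
    have I: "{1..Suc n} = insert (Suc n) {1..n}" by auto
    have "(\<integral>\<^sup>+w. ?f (Suc n) w \<partial>(\<Pi>\<^sub>M k\<in>{1..Suc n}. Q)) =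
        (\<integral>\<^sup>+w. \<integral>\<^sup>+B. ?f (Suc n) (w(Suc n := B)) \<partial>Q \<partial>(\<Pi>\<^sub>M k\<in>{1..n}. Q))"
      unfolding I using meas[of "Suc n" "{1..Suc n}"]
      by (intro P.product_nn_integral_insert) (auto simp flip: I)
    also have "\<dots> = (\<integral>\<^sup>+w. ?f n w * ennreal (d s) \<partial>(\<Pi>\<^sub>M k\<in>{1..n}. Q))"
    proof (rule nn_integral_cong)
      fix w :: "nat \<Rightarrow> 'a ^ 'n ^ 'n"
      have "matrix_product (w(Suc n := B)) n = matrix_product w n" for B
        by (rule matrix_product_cong) simp
      then show "(\<integral>\<^sup>+B. ?f (Suc n) (w(Suc n := B)) \<partial>Q) = ?f n w * ennreal (d s)"
        by (simp add: moments_scaled[OF s] flip: matrix_vector_mul_assoc)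
    qed
    also have "\<dots> = (\<integral>\<^sup>+w. ?f n w \<partial>(\<Pi>\<^sub>M k\<in>{1..n}. Q)) * ennreal (d s)"
      by (intro nn_integral_multc meas order_refl)
    also have "\<dots> = ennreal (d s) ^ Suc n"
      by (simp only: Suc power_Suc mult.commute)
    finally show ?case .
  qed
  show ?thesis
  \<comment> \<open>The characterisation of independence by the joint law requires a nonempty index
    set.\<close>
  proof (cases "n = 0")
    case False
    have rv: "A k \<in> borel_measurable M" if "k \<in> {1..n}" for k
      using that by simp
    have "indep_vars (\<lambda>_. borel) A {1..n}"
      using indep by (rule indep_vars_subset) auto
    then have "distr M (\<Pi>\<^sub>M k\<in>{1..n}. borel) (\<lambda>\<omega>. \<lambda>k\<in>{1..n}. A k \<omega>) = (\<Pi>\<^sub>M k\<in>{1..n}. distr M borel (A k))"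
      using False rv by (subst (asm) indep_vars_iff_distr_eq_PiM') auto
    also have "\<dots> = (\<Pi>\<^sub>M k\<in>{1..n}. Q)"
      by (intro PiM_cong) (auto intro: law)
    finally have joint: "distr M (\<Pi>\<^sub>M k\<in>{1..n}. borel) (\<lambda>\<omega>. \<lambda>k\<in>{1..n}. A k \<omega>) = (\<Pi>\<^sub>M k\<in>{1..n}. Q)" .
    have "ennreal (d s) ^ n = (\<integral>\<^sup>+w. ?f n w \<partial>distr M (\<Pi>\<^sub>M k\<in>{1..n}. borel) (\<lambda>\<omega>. \<lambda>k\<in>{1..n}. A k \<omega>))"
      by (simp only: joint PiM)
    also have "\<dots> = (\<integral>\<^sup>+\<omega>. ?f n (\<lambda>k\<in>{1..n}. A k \<omega>) \<partial>M)"
    proof (rule nn_integral_distr)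
      show "(\<lambda>\<omega>. \<lambda>k\<in>{1..n}. A k \<omega>) \<in> M \<rightarrow>\<^sub>M (\<Pi>\<^sub>M k\<in>{1..n}. borel)"
        using rv by (intro measurable_restrict) auto
      show "?f n \<in> borel_measurable (distr M (\<Pi>\<^sub>M k\<in>{1..n}. borel) (\<lambda>\<omega>. \<lambda>k\<in>{1..n}. A k \<omega>))"
        unfolding joint by (rule meas) simp
    qed
    also have "\<dots> = (\<integral>\<^sup>+\<omega>. ?f n (\<lambda>k. A k \<omega>) \<partial>M)"
    proof (rule nn_integral_cong)
      fix \<omega>
      have "matrix_product (\<lambda>k\<in>{1..n}. A k \<omega>) n = matrix_product (\<lambda>k. A k \<omega>) n"
        by (rule matrix_product_cong) simp
      then show "?f n (\<lambda>k\<in>{1..n}. A k \<omega>) = ?f n (\<lambda>k. A k \<omega>)"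
        by (simp only:)
    qed
    finally show ?thesis ..
  qed (simp add: u emeasure_space_1)
qed

section \<open>Almost sure exponential growth of the products\<close>

abbreviation P :: "nat \<Rightarrow> 'w \<Rightarrow> 'a ^ 'n ^ 'n" where
  "P n \<omega> \<equiv> matrix_product (\<lambda>k. A k \<omega>) n"

lemma P_measurable [measurable]: "P n \<in> borel_measurable M"
  by (rule matrix_product_measurable) simp

text \<open>As \<open>0 powr 0 = 0\<close>, the moment of order 0 is the probability that the vector
  does not vanish, and it equals \<open>d 0 ^ n = 1\<close>.\<close>

lemma AE_nonzero:
  assumes u: "norm u = 1"
  shows "AE \<omega> in M. \<forall>n. P n \<omega> *v u \<noteq> 0"
proof -
  have "AE \<omega> in M. P n \<omega> *v u \<noteq> 0" for n
  proof -
    have "1 = (\<integral>\<^sup>+\<omega>. ennreal (norm (P n \<omega> *v u) powr 0) \<partial>M)"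
      using moments_product[OF u, of 0 n] by (simp add: moment_0)
    also have "\<dots> = (\<integral>\<^sup>+\<omega>. indicator {\<omega> \<in> space M. P n \<omega> *v u \<noteq> 0} \<omega> \<partial>M)"
      by (intro nn_integral_cong) (simp add: indicator_def)
    also have "\<dots> = emeasure M {\<omega> \<in> space M. P n \<omega> *v u \<noteq> 0}"
      by (rule nn_integral_indicator) measurable
    finally have "prob {\<omega> \<in> space M. P n \<omega> *v u \<noteq> 0} = 1"
      by (simp add: emeasure_eq_measure)
    then show ?thesis
      by (simp add: prob_Collect_eq_1)
  qed
  then show ?thesis
    by (simp add: AE_all_countable)
qed

text \<open>The exceptional events have probability at most the powers of
  \<open>d t / exp (t * \<kappa>) < 1\<close>, which are summable. For \<open>t > 0\<close> this
  bounds the growth rate by \<kappa> from above, for \<open>t < 0\<close> from below.\<close>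

lemma AE_eventually_powr_less:
  assumes u: "norm u = 1" and t: "\<bar>t\<bar> < 1" and less: "d t < exp (t * \<kappa>)"
  shows "AE \<omega> in M. eventually (\<lambda>n. norm (P n \<omega> *v u) powr t < exp (t * \<kappa> * real n)) sequentially"
proof -
  define E where "E n = {\<omega> \<in> space M. 1 \<le> ennreal (exp (- (t * \<kappa> * real n))) * ennreal (norm (P n \<omega> *v u) powr t)}" for n
  define r where "r = d t / exp (t * \<kappa>)"
  have r: "0 \<le> r" "r < 1"
    using less moment_nonneg[of t] by (simp_all add: r_def)
  have E [measurable]: "E n \<in> sets M" for n
    unfolding E_def by measurable
  have bound: "measure M (E n) \<le> r ^ n" for n
  proof -
    have "emeasure M (E n) \<le> ennreal (exp (- (t * \<kappa> * real n))) * (\<integral>\<^sup>+\<omega>. ennreal (norm (P n \<omega> *v u) powr t) * indicator (space M) \<omega> \<partial>M)"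
      unfolding E_def by (rule nn_integral_Markov_inequality) measurable
    also have "(\<integral>\<^sup>+\<omega>. ennreal (norm (P n \<omega> *v u) powr t) * indicator (space M) \<omega> \<partial>M) = ennreal (d t) ^ n"
      unfolding moments_product[OF u t, symmetric] by (intro nn_integral_cong) simp
    also have "ennreal (exp (- (t * \<kappa> * real n))) * ennreal (d t) ^ n = ennreal (r ^ n)"
    proof -
      have "exp (- (t * \<kappa> * real n)) * d t ^ n = r ^ n"
        by (simp only: r_def power_divide exp_minus exp_of_nat2_mult) (simp add: divide_inverse)
      then show ?thesis
        using moment_nonneg[of t] by (simp add: ennreal_power flip: ennreal_mult')
    qed
    finally show ?thesis
      using r by (simp add: emeasure_eq_measure)
  qed
  have "summable (\<lambda>n. measure M (E n))"
    by (rule summable_comparison_test'[OF summable_geometric[of r]]) (use r bound in auto)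
  then have "AE \<omega> in M. eventually (\<lambda>n. \<omega> \<in> space M - E n) sequentially"
    by (intro borel_cantelli_AE1) (auto simp: emeasure_eq_measure)
  then show ?thesis
  proof eventually_elim
    case (elim \<omega>)
    then show ?case
    proof eventually_elim
      case (elim n)
      then have "\<not> 1 \<le> exp (- (t * \<kappa> * real n)) * norm (P n \<omega> *v u) powr t"
        by (simp add: E_def flip: ennreal_mult' ennreal_1)
      then show ?case
        by (simp add: exp_minus field_simps)
    qed
  qed
qed

lemma AE_eventually_norm_bounds:
  assumes u: "norm u = 1" and \<epsilon>: "\<epsilon> > 0"
  shows "AE \<omega> in M. eventually (\<lambda>n. exp ((\<mu> - \<epsilon>) * real n) < norm (P n \<omega> *v u) \<and>
    norm (P n \<omega> *v u) < exp ((\<mu> + \<epsilon>) * real n)) sequentially"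
proof -
  \<comment> \<open>\<open>d\<close> and both exponentials equal 1 at 0, with slopes \<mu>, \<mu> +
    \<epsilon> and \<mu> - \<epsilon>. So \<open>d\<close> lies below the first just right of 0 and
    below the second just left of 0.\<close>
  have "((\<lambda>t. d t - exp (t * (\<mu> + \<epsilon>))) has_real_derivative - \<epsilon>) (at 0)"
    by (auto intro!: derivative_eq_intros moment_deriv)
  from DERIV_neg_dec_right[OF this] obtain \<delta>1 where \<delta>1: "\<delta>1 > 0"
    "\<And>h. 0 < h \<Longrightarrow> h < \<delta>1 \<Longrightarrow> d h < exp (h * (\<mu> + \<epsilon>))"
    using \<epsilon> by (auto simp: moment_0)
  have "((\<lambda>t. d t - exp (t * (\<mu> - \<epsilon>))) has_real_derivative \<epsilon>) (at 0)"
    by (auto intro!: derivative_eq_intros moment_deriv)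
  from DERIV_pos_inc_left[OF this] obtain \<delta>2 where \<delta>2: "\<delta>2 > 0"
    "\<And>h. 0 < h \<Longrightarrow> h < \<delta>2 \<Longrightarrow> d (- h) < exp (- h * (\<mu> - \<epsilon>))"
    using \<epsilon> by (auto simp: moment_0)
  define t where "t = min (1 / 2) (min \<delta>1 \<delta>2) / 2"
  have t: "0 < t" "t < 1" "t < \<delta>1" "t < \<delta>2"
    using \<delta>1(1) \<delta>2(1) by (auto simp: t_def min_def)
  have 1: "AE \<omega> in M. eventually (\<lambda>n. norm (P n \<omega> *v u) powr t < exp (t * (\<mu> + \<epsilon>) * real n)) sequentially"
    using t \<delta>1(2) by (intro AE_eventually_powr_less u) auto
  have 2: "AE \<omega> in M. eventually (\<lambda>n. norm (P n \<omega> *v u) powr - t < exp (- t * (\<mu> - \<epsilon>) * real n)) sequentially"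
    using t \<delta>2(2)[of t] by (intro AE_eventually_powr_less u) auto
  show ?thesis
    using 1 2 AE_nonzero[OF u]
  proof eventually_elim
    case (elim \<omega>)
    from elim(1,2) show ?case
    proof eventually_elim
      case (elim n)
      have pos: "norm (P n \<omega> *v u) > 0"
        using \<open>\<forall>n. P n \<omega> *v u \<noteq> 0\<close> by simp
      define l where "l = ln (norm (P n \<omega> *v u))"
      have l: "norm (P n \<omega> *v u) = exp l"
        using pos by (simp add: l_def)
      have "t * l < t * ((\<mu> + \<epsilon>) * real n)" "- t * l < - t * ((\<mu> - \<epsilon>) * real n)"
        using elim by (simp_all add: l powr_def mult.assoc)
      then show ?case
        using t(1) by (simp add: l)
    qed
  qed
qed

theorem lyapunov_exponent: "largest_lyapunov_exponent M A \<mu>"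
proof -
  \<comment> \<open>Tolerances \<open>1 / Suc m\<close> keep the exceptional null sets countable, so
    a single null set serves every \<epsilon>.\<close>
  define E where "E j m \<omega> \<longleftrightarrow> eventually (\<lambda>n. exp ((\<mu> - 1 / Suc m) * real n) < norm (P n \<omega> *v axis j 1) \<and>
    norm (P n \<omega> *v axis j 1) < exp ((\<mu> + 1 / Suc m) * real n)) sequentially" for j :: 'n and m \<omega>
  have "AE \<omega> in M. E j m \<omega>" for j m
    unfolding E_def by (intro AE_eventually_norm_bounds) (simp_all add: norm_axis)
  then have "AE \<omega> in M. \<forall>m. \<forall>j\<in>UNIV. E j m \<omega>"
    by (simp add: AE_all_countable AE_finite_all)
  then show ?thesis
    unfolding largest_lyapunov_exponent_def
  proof eventually_elim
    case (elim \<omega>)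
    show ?case
    proof (rule tendstoI)
      fix \<epsilon> :: real assume \<epsilon>: "\<epsilon> > 0"
      obtain m where m: "1 / Suc m < \<epsilon> / 2"
        using nat_approx_posE[of "\<epsilon> / 2"] \<epsilon> by auto
      \<comment> \<open>The other half of \<epsilon> pays for summing over the standard basis in the
        upper bound of the operator norm.\<close>
      have "(\<lambda>n. ln (real CARD('n)) / real n) \<longlonglongrightarrow> 0"
        by real_asymp
      from tendstoD[OF this, of "\<epsilon> / 2"] \<epsilon>
      have "eventually (\<lambda>n. ln (real CARD('n)) / real n < \<epsilon> / 2) sequentially"
        by (auto simp: dist_real_def elim!: eventually_mono)
      moreover have "eventually (\<lambda>n. \<forall>j\<in>UNIV. exp ((\<mu> - 1 / Suc m) * real n) < norm (P n \<omega> *v axis j 1) \<and>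
        norm (P n \<omega> *v axis j 1) < exp ((\<mu> + 1 / Suc m) * real n)) sequentially"
        using elim unfolding E_def by (intro eventually_ball_finite) auto
      ultimately show "eventually (\<lambda>n. dist (ln (onorm (\<lambda>v. P n \<omega> *v v)) / real n) \<mu> < \<epsilon>) sequentially"
        using eventually_gt_at_top[of 0]
      proof eventually_elim
        case (elim n)
        let ?N = "onorm (\<lambda>v. P n \<omega> *v v)"
        have lower: "exp ((\<mu> - 1 / Suc m) * real n) < ?N"
          using elim(2) onorm_matrix_bounds(1)[of "P n \<omega>"] by (meson UNIV_I less_le_trans)
        have "?N \<le> (\<Sum>j\<in>UNIV. norm (P n \<omega> *v axis j 1))"
          by (rule onorm_matrix_bounds)
        also have "\<dots> \<le> (\<Sum>j\<in>(UNIV :: 'n set). exp ((\<mu> + 1 / Suc m) * real n))"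
          using elim(2) by (intro sum_mono) (auto intro: less_imp_le)
        also have "\<dots> = exp (ln (real CARD('n)) + (\<mu> + 1 / Suc m) * real n)"
          by (simp add: exp_add)
        finally have upper: "?N \<le> exp (ln (real CARD('n)) + (\<mu> + 1 / Suc m) * real n)" .
        have pos: "?N > 0"
          using lower by (rule order.strict_trans[OF exp_gt_zero])
        have "(\<mu> - 1 / Suc m) * real n < ln ?N"
          using lower pos by (metis exp_less_cancel_iff exp_ln)
        moreover have "ln ?N \<le> ln (real CARD('n)) + (\<mu> + 1 / Suc m) * real n"
          using upper pos by (metis ln_exp ln_le_cancel_iff exp_gt_zero)
        then have "ln ?N / real n \<le> (ln (real CARD('n)) + (\<mu> + 1 / Suc m) * real n) / real n"
          by (rule divide_right_mono) simp
        ultimately have "\<mu> - 1 / Suc m < ln ?N / real n" "ln ?N / real n \<le> ln (real CARD('n)) / real n + (\<mu> + 1 / Suc m)"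
          using elim(3) by (simp_all add: less_divide_eq add_divide_distrib)
        with m elim(1) show ?case
          unfolding dist_real_def abs_less_iff by linarith
      qed
    qed
  qed
qed

end

text \<open>\<open>|A u| powr s\<close> is \<open>(2 / \<beta>) powr (s / 2)\<close> times
  \<open>W u A powr (s / 2)\<close>, so the window 1/2 for \<open>W\<close> becomes 1 for the norm.
  Differentiating this product at 0 gives \<open>2 * \<mu> = ln (2 / \<beta>) + E ln W\<close>, the
  source of the term \<open>ln (2 / \<beta>)\<close>.\<close>

lemma gaussian_lyapunov:
  fixes S :: "'a::star_scalar ^ 'n ^ 'n"
  assumes M: "prob_space M" and pd: "positive_definite S" and ev: "eigenvalues_with_mult S (\<lambda>i. 1 / y i)"
    and y: "\<And>i. y i > 0" and iid: "iid_gaussian_matrices M S A"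
  shows "\<exists>\<mu>. largest_lyapunov_exponent M A \<mu> \<and>
    2 * \<mu> = - euler_mascheroni + ln (2 / DIM('a)) +
      (LBINT x:{0<..}. (indicator {0..1} x - product_transform y (DIM('a) / 2) x) / x)"
proof -
  define \<beta> where "\<beta> = real DIM('a)"
  have \<beta>: "\<beta> > 0" by (simp add: \<beta>_def)
  define W where "W u A = \<beta> / 2 * (norm (A *v u))\<^sup>2" for u :: "'a ^ 'n" and A :: "'a ^ 'n ^ 'n"
  have law: "product_laplace_law (gaussian_law S) (W u) y (\<beta> / 2)" if "norm u = 1" for u
    using gaussian_law_laplace[OF pd ev y that] by (simp add: W_def[abs_def] \<beta>_def)
  define e where "e = axis (undefined :: 'n) (1::'a)"
  have e: "norm e = 1" by (simp add: e_def norm_axis)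
  interpret W: product_laplace_law "gaussian_law S" "W e" y "\<beta> / 2"
    by (rule law[OF e])
  define d where "d s = (2 / \<beta>) powr (s / 2) * W.expectation (\<lambda>A. W e A powr (s / 2))" for s
  define \<mu> where "\<mu> = (ln (2 / \<beta>) + W.expectation (\<lambda>A. ln (W e A))) / 2"
  \<comment> \<open>Isotropy at the level of moments, with \<open>e\<close> as the reference vector.
    The order 0 lies outside the Mellin formula and follows from positivity almost
    everywhere.\<close>
  have same: "(\<integral>\<^sup>+A. ennreal (W u A powr s) \<partial>gaussian_law S) = (\<integral>\<^sup>+A. ennreal (W e A powr s) \<partial>gaussian_law S)"
    if u: "norm u = 1" and s: "\<bar>s\<bar> < 1 / 2" for u s
  proof (cases "s = 0")
    case True
    have "(\<integral>\<^sup>+A. ennreal (W v A powr 0) \<partial>gaussian_law S) = (\<integral>\<^sup>+A. 1 \<partial>gaussian_law S)" if "norm v = 1" for v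
      using product_laplace_law.AE_pos[OF law[OF that]] by (intro nn_integral_cong_AE) auto
    then show ?thesis using True u e by simp
  next
    case False
    then show ?thesis
      using product_laplace_law.nn_integral_powr(1)[OF law[OF u], of s] W.nn_integral_powr(1)[of s] s by simp
  qed
  have norm_W: "norm (A *v u) powr s = (2 / \<beta>) powr (s / 2) * W u A powr (s / 2)" for A u s
  proof -
    have "(norm (A *v u))\<^sup>2 = 2 / \<beta> * W u A"
      using \<beta> by (simp add: W_def)
    moreover have "norm (A *v u) powr s = ((norm (A *v u))\<^sup>2) powr (s / 2)"
      by (cases "A *v u = 0") (simp_all add: powr_powr flip: powr_numeral)
    ultimately show ?thesis
      by (simp only: powr_mult)
  qed
  interpret isotropic_matrix_products M A "gaussian_law S" d \<mu>
  proof (intro isotropic_matrix_products.intro isotropic_matrix_products_axioms.intro M)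
    show "prob_space.indep_vars M (\<lambda>_. borel) A {1..}" "\<And>k. 1 \<le> k \<Longrightarrow> distr M borel (A k) = gaussian_law S"
      using iid by (auto simp: iid_gaussian_matrices_def)
    show "(\<integral>\<^sup>+B. ennreal (norm (B *v u) powr s) \<partial>gaussian_law S) = ennreal (d s)"
      if "norm u = 1" "\<bar>s\<bar> < 1" for u s
    proof -
      have [measurable]: "W u \<in> borel_measurable (gaussian_law S)" for u
        unfolding W_def by measurable
      have "(\<integral>\<^sup>+B. ennreal (norm (B *v u) powr s) \<partial>gaussian_law S) =
          ennreal ((2 / \<beta>) powr (s / 2)) * (\<integral>\<^sup>+A. ennreal (W u A powr (s / 2)) \<partial>gaussian_law S)"
        by (simp add: norm_W ennreal_mult nn_integral_cmult)
      also have "(\<integral>\<^sup>+A. ennreal (W u A powr (s / 2)) \<partial>gaussian_law S) = ennreal (W.expectation (\<lambda>A. W e A powr (s / 2)))"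
        unfolding same[OF that(1), of "s / 2", simplified, OF that(2)]
        using that(2) by (intro nn_integral_eq_integral W.integrable_powr) auto
      finally show ?thesis
        by (simp add: d_def ennreal_mult)
    qed
    show "d s \<ge> 0" for s
      by (simp add: d_def)
    have "AE A in gaussian_law S. W e A powr 0 = 1"
      using W.AE_pos by eventually_elim simp
    then have E0: "W.expectation (\<lambda>A. W e A powr 0) = 1"
      by (subst integral_cong_AE[of _ _ "\<lambda>_. 1"]) (auto simp: W.prob_space)
    then show "d 0 = 1"
      using \<beta> by (simp add: d_def)
    have 1: "((\<lambda>s. W.expectation (\<lambda>A. W e A powr (s / 2))) has_real_derivative W.expectation (\<lambda>A. ln (W e A)) * (1 / 2)) (at 0)"
      by (rule DERIV_chain'[where f = "\<lambda>s. s / 2" and g = "\<lambda>s. W.expectation (\<lambda>A. W e A powr s)"])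
        (auto intro!: derivative_eq_intros W.moment_derivative)
    have 2: "((\<lambda>s. (2 / \<beta>) powr (s / 2)) has_real_derivative ln (2 / \<beta>) / 2) (at 0)"
      using \<beta> by (auto intro!: derivative_eq_intros simp: powr_def)
    have "(d has_real_derivative ln (2 / \<beta>) / 2 * W.expectation (\<lambda>A. W e A powr (0 / 2)) +
        W.expectation (\<lambda>A. ln (W e A)) * (1 / 2) * (2 / \<beta>) powr (0 / 2)) (at 0)"
      unfolding d_def[abs_def] by (rule DERIV_mult[OF 2 1])
    then show "(d has_real_derivative \<mu>) (at 0)"
      using \<beta> by (simp only: div_0 E0) (simp add: \<mu>_def add_divide_distrib)
  qed
  have "2 * \<mu> = - euler_mascheroni + ln (2 / \<beta>) +
      (LBINT x:{0<..}. (indicator {0..1} x - product_transform y (\<beta> / 2) x) / x)"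
    using W.expectation_ln by (simp add: \<mu>_def)
  then show ?thesis
    using lyapunov_exponent unfolding \<beta>_def by blast
qed

theorem theorem1p1:
  fixes M :: "'w measure" and y :: "'n::finite \<Rightarrow> real"
    and \<Sigma>1 :: "real ^ 'n ^ 'n" and A1 :: "nat \<Rightarrow> 'w \<Rightarrow> real ^ 'n ^ 'n"
    and \<Sigma>2 :: "complex ^ 'n ^ 'n" and A2 :: "nat \<Rightarrow> 'w \<Rightarrow> complex ^ 'n ^ 'n"
    and \<Sigma>4 :: "quat ^ 'n ^ 'n" and A4 :: "nat \<Rightarrow> 'w \<Rightarrow> quat ^ 'n ^ 'n"
  assumes "prob_space M" and "\<And>i. y i > 0"
  shows
    "(positive_definite \<Sigma>1 \<and> eigenvalues_with_mult \<Sigma>1 (\<lambda>i. 1 / y i) \<and>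
        iid_gaussian_matrices M \<Sigma>1 A1 \<longrightarrow>
      (\<exists>\<mu>. largest_lyapunov_exponent M A1 \<mu> \<and>
        2 * \<mu> = - euler_mascheroni + ln (2 / 1) +
          (LBINT x:{0<..}. (indicator {0..1} x - (\<Prod>i\<in>UNIV. (1 + x / y i) powr (- (1 / 2)))) / x))) \<and>
     (positive_definite \<Sigma>2 \<and> eigenvalues_with_mult \<Sigma>2 (\<lambda>i. 1 / y i) \<and>
        iid_gaussian_matrices M \<Sigma>2 A2 \<longrightarrow>
      (\<exists>\<mu>. largest_lyapunov_exponent M A2 \<mu> \<and>
        2 * \<mu> = - euler_mascheroni + ln (2 / 2) +
          (LBINT x:{0<..}. (indicator {0..1} x - (\<Prod>i\<in>UNIV. (1 + x / y i) powr (- (2 / 2)))) / x))) \<and>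
     (positive_definite \<Sigma>4 \<and> eigenvalues_with_mult \<Sigma>4 (\<lambda>i. 1 / y i) \<and>
        iid_gaussian_matrices M \<Sigma>4 A4 \<longrightarrow>
      (\<exists>\<mu>. largest_lyapunov_exponent M A4 \<mu> \<and>
        2 * \<mu> = - euler_mascheroni + ln (2 / 4) +
          (LBINT x:{0<..}. (indicator {0..1} x - (\<Prod>i\<in>UNIV. (1 + x / y i) powr (- (4 / 2)))) / x)))"
proof (intro conjI impI; elim conjE)
  assume "positive_definite \<Sigma>1" "eigenvalues_with_mult \<Sigma>1 (\<lambda>i. 1 / y i)" "iid_gaussian_matrices M \<Sigma>1 A1"
  from gaussian_lyapunov[OF assms(1) this(1,2) assms(2) this(3)]
  show "\<exists>\<mu>. largest_lyapunov_exponent M A1 \<mu> \<and>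
        2 * \<mu> = - euler_mascheroni + ln (2 / 1) +
          (LBINT x:{0<..}. (indicator {0..1} x - (\<Prod>i\<in>UNIV. (1 + x / y i) powr (- (1 / 2)))) / x)"
    by (simp only: product_transform_def DIM_real of_nat_1)
next
  assume "positive_definite \<Sigma>2" "eigenvalues_with_mult \<Sigma>2 (\<lambda>i. 1 / y i)" "iid_gaussian_matrices M \<Sigma>2 A2"
  from gaussian_lyapunov[OF assms(1) this(1,2) assms(2) this(3)]
  show "\<exists>\<mu>. largest_lyapunov_exponent M A2 \<mu> \<and>
        2 * \<mu> = - euler_mascheroni + ln (2 / 2) +
          (LBINT x:{0<..}. (indicator {0..1} x - (\<Prod>i\<in>UNIV. (1 + x / y i) powr (- (2 / 2)))) / x)"
    by (simp only: product_transform_def DIM_complex of_nat_numeral)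
next
  assume "positive_definite \<Sigma>4" "eigenvalues_with_mult \<Sigma>4 (\<lambda>i. 1 / y i)" "iid_gaussian_matrices M \<Sigma>4 A4"
  from gaussian_lyapunov[OF assms(1) this(1,2) assms(2) this(3)]
  show "\<exists>\<mu>. largest_lyapunov_exponent M A4 \<mu> \<and>
        2 * \<mu> = - euler_mascheroni + ln (2 / 4) +
          (LBINT x:{0<..}. (indicator {0..1} x - (\<Prod>i\<in>UNIV. (1 + x / y i) powr (- (4 / 2)))) / x)"
    by (simp only: product_transform_def DIM_quat of_nat_numeral)
qed

end
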